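(* If $G$ is a nonabelian finite $Z$-group with $\mathbf{Z}(G)=\{1\}$ and $G$ is not a Frobenius group, then the commuting graph $\Gamma(G)$ of $G$ is connected with diameter $3$ or $4$.
   Context: A $Z$-group is a group in which every Sylow subgroup is cyclic. $\mathbf{Z}(G)$ denotes the center of $G$. For a nonabelian group $G$, the commuting graph $\Gamma(G)$ is the simple graph whose vertices are the non-central elements of $G$, with an edge between distinct vertices $x$ and $y$ if and only if $xy=yx$. A group $G$ is a Frobenius group if it has a nontrivial proper subgroup $H$ such that $H\cap H^{g}=\{1\}$ for each $g\in G\setminus H$, where $H^g=g^{-1}Hg$. The diameter of a connected graph is the maximum distance (length of a shortest path) between two vertices. *)

theory Defs
  imports
    "HOL-Computational_Algebra.Primes"
    "HOL-Algebra.Elementary_Groups"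
    "Graph_Theory.Graph_Theory"
begin

definition center :: "('a, 'b) monoid_scheme \<Rightarrow> 'a set" where
  "center G = {z \<in> carrier G. \<forall>g \<in> carrier G. g \<otimes>\<^bsub>G\<^esub> z = z \<otimes>\<^bsub>G\<^esub> g}"

text \<open>For finite groups. If the prime \<open>p\<close> does not divide the group order, the only Sylow
  \<open>p\<close>-subgroup in this sense is the trivial one, which is cyclic.\<close>

definition sylow_subgroup :: "('a, 'b) monoid_scheme \<Rightarrow> nat \<Rightarrow> 'a set \<Rightarrow> bool" where
  "sylow_subgroup G p P \<longleftrightarrow>
     Factorial_Ring.prime p \<and> subgroup P G \<and> card P = p ^ multiplicity p (order G)"

definition Z_group :: "('a, 'b) monoid_scheme \<Rightarrow> bool" where
  "Z_group G \<longleftrightarrow> group G \<and> (\<forall>p P. sylow_subgroup G p P \<longrightarrow> cyclic_group (G\<lparr>carrier := P\<rparr>))"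

definition frobenius_group :: "('a, 'b) monoid_scheme \<Rightarrow> bool" where
  "frobenius_group G \<longleftrightarrow> group G \<and>
     (\<exists>H. subgroup H G \<and> H \<noteq> {\<one>\<^bsub>G\<^esub>} \<and> H \<noteq> carrier G \<and>
        (\<forall>g \<in> carrier G - H. H \<inter> ((inv\<^bsub>G\<^esub> g <#\<^bsub>G\<^esub> H) #>\<^bsub>G\<^esub> g) = {\<one>\<^bsub>G\<^esub>}))"

text \<open>A simple graph is represented by a symmetric loop-free digraph.\<close>

definition commuting_graph :: "('a, 'b) monoid_scheme \<Rightarrow> 'a pair_pre_digraph" where
  "commuting_graph G =
     \<lparr>pverts = carrier G - center G,
      parcs = {(x, y). x \<in> carrier G - center G \<and> y \<in> carrier G - center G \<and>
                 x \<noteq> y \<and> x \<otimes>\<^bsub>G\<^esub> y = y \<otimes>\<^bsub>G\<^esub> x}\<rparr>"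

lemma pair_graph_commuting_graph:
  assumes "finite (carrier G)"
  shows "pair_graph (commuting_graph G)"
proof
  let ?V = "carrier G - center G"
  show "finite (pverts (commuting_graph G))"
    using assms by (simp add: commuting_graph_def)
  have "parcs (commuting_graph G) \<subseteq> ?V \<times> ?V"
    by (auto simp: commuting_graph_def)
  then show "finite (parcs (commuting_graph G))"
    using assms by (meson finite_Diff finite_SigmaI finite_subset)
qed (auto simp: commuting_graph_def symmetric_def sym_def)

text \<open>With all arc weights equal to 1, \<open>wf_digraph.\<mu> G (\<lambda>_. 1) u v\<close> is the least number of arcs
  of a walk from \<open>u\<close> to \<open>v\<close> (and \<open>\<infinity>\<close> if there is none), i.e. the length of a shortest path.
  For a finite nonempty vertex set the supremum is a maximum.\<close>

definition graph_diameter :: "('a, 'b) pre_digraph \<Rightarrow> ereal" where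
  "graph_diameter G = (SUP u \<in> verts G. SUP v \<in> verts G. wf_digraph.\<mu> G (\<lambda>_. 1) u v)"

end

theory Submission
  imports Defs "HOL-Algebra.Multiplicative_Group" "HOL-Algebra.Sylow"
    "HOL-Algebra.Group_Action" "HOL-Algebra.Zassenhaus" "HOL-Number_Theory.Totient"
begin

text \<open>
  The proof rests on the structure of a Z-group \<open>G\<close> with trivial center: \<open>G = A B\<close> with cyclic
  subgroups \<open>A = \<langle>a\<rangle>\<close> and \<open>B = \<langle>b\<rangle>\<close> of coprime orders, where \<open>A\<close> is normal and equal to its own
  centralizer (\<open>ex_cyclic_hall_factorization\<close>).

  Once this is known, the corollary is short. If no nontrivial element of \<open>A\<close> commuted with a
  nontrivial element of \<open>B\<close>, then \<open>B\<close> would be a Frobenius complement. As \<open>G\<close> is not a Frobenius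
  group, there are \<open>a\<^sub>0 \<noteq> 1\<close> in \<open>A\<close> and \<open>b\<^sub>0 \<noteq> 1\<close> in \<open>B\<close> that commute. A vertex \<open>x\<close> with
  \<open>x\<^bsup>|B|\<^esup> \<noteq> 1\<close> commutes with that power, which lies in the abelian group \<open>A\<close> and so commutes with
  \<open>a\<^sub>0\<close>. A vertex with \<open>x\<^bsup>|B|\<^esup> = 1\<close> lies in a conjugate of \<open>B\<close> by an element of \<open>A\<close>; it
  commutes with the corresponding conjugate of \<open>b\<^sub>0\<close>, which commutes with \<open>a\<^sub>0\<close> because \<open>a\<^sub>0\<close> is
  fixed under conjugation by \<open>A\<close>. Hence every vertex has distance at most 2 from \<open>a\<^sub>0\<close>, and any two
  have distance at most 4. Conversely, the generators \<open>a\<close> and \<open>b\<close> have distance at least 3, since an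
  element that commutes with both is central.

  The factorization is the classical theorem of Hoelder, Burnside and Zassenhaus. Solvability comes
  from counting instead of transfer. Frobenius showed that \<open>n\<close> divides the number of solutions of
  \<open>x\<^sup>n = 1\<close> in \<open>G\<close> whenever \<open>n\<close> divides \<open>|G|\<close> (\<open>frobenius_dvd_card_roots\<close>). When the Sylow
  subgroups are cyclic and \<open>n\<close> is the part of \<open>|G|\<close> made up of the primes that are at least \<open>q\<close>,
  this number is exactly \<open>n\<close> (\<open>card_roots_large_part\<close>), and the solutions form a normal subgroup.
  Letting \<open>q\<close> vary gives a normal series with cyclic factors. With it one sees that a maximal
  abelian normal subgroup \<open>A\<close> is its own centralizer
  (\<open>ex_self_centralizing_normal_abelian\<close>). It is cyclic, so \<open>G / A\<close> embeds in the abelian group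
  of automorphisms of \<open>A\<close>; thus \<open>G / A\<close> is abelian and, its Sylow subgroups being cyclic, cyclic. Trivial center forces
  \<open>|A|\<close> and \<open>|G / A|\<close> to be coprime, and then the complement \<open>B\<close> is generated by a power of any
  element whose image generates \<open>G / A\<close>.
\<close>

section \<open>Solutions of \<open>x\<^sup>n = 1\<close> and conjugation\<close>

definition roots :: "('a, 'b) monoid_scheme \<Rightarrow> nat \<Rightarrow> 'a set" where
  "roots G n = {x \<in> carrier G. x [^]\<^bsub>G\<^esub> n = \<one>\<^bsub>G\<^esub>}"

definition centralizer :: "('a, 'b) monoid_scheme \<Rightarrow> 'a \<Rightarrow> 'a set" where
  "centralizer G z = {g \<in> carrier G. g \<otimes>\<^bsub>G\<^esub> z = z \<otimes>\<^bsub>G\<^esub> g}"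

context group
begin

lemma cancel_inv_left:
  assumes "x \<in> carrier G" "y \<in> carrier G"
  shows "inv x \<otimes> (x \<otimes> y) = y" "x \<otimes> (inv x \<otimes> y) = y"
  using assms by (simp_all flip: m_assoc)

lemma pow_eq_if_cong:
  fixes a b k :: nat
  assumes "x \<in> carrier G" "x [^] k = \<one>" "[a = b] (mod k)"
  shows "x [^] a = x [^] b"
proof -
  have "x [^] a = x [^] (a mod k)" for a
  proof -
    have "x [^] a = x [^] (k * (a div k) + a mod k)" by simp
    also have "\<dots> = (x [^] k) [^] (a div k) \<otimes> x [^] (a mod k)"
      using assms(1) by (metis nat_pow_mult nat_pow_pow)
    also have "\<dots> = x [^] (a mod k)" using assms by simp
    finally show ?thesis .
  qed
  then show ?thesis using assms(3) unfolding cong_def by metis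
qed

lemma roots_iff: "x \<in> roots G n \<longleftrightarrow> x \<in> carrier G \<and> ord x dvd n"
  by (auto simp: roots_def pow_eq_id)

lemma roots_gcd: "roots G m \<inter> roots G n = roots G (gcd m n)"
  by (auto simp: roots_iff)

lemma roots_order: "roots G (order G) = carrier G"
  by (auto simp: roots_iff ord_dvd_group_order)

lemma conj_mult:
  assumes "g \<in> carrier G" "x \<in> carrier G" "y \<in> carrier G"
  shows "(g \<otimes> x \<otimes> inv g) \<otimes> (g \<otimes> y \<otimes> inv g) = g \<otimes> (x \<otimes> y) \<otimes> inv g"
  using assms by (simp add: m_assoc cancel_inv_left)

lemma commute_conj:
  assumes "g \<in> carrier G" "x \<in> carrier G" "y \<in> carrier G" "x \<otimes> y = y \<otimes> x"
  shows "(g \<otimes> x \<otimes> inv g) \<otimes> (g \<otimes> y \<otimes> inv g) = (g \<otimes> y \<otimes> inv g) \<otimes> (g \<otimes> x \<otimes> inv g)"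
  using assms by (simp add: conj_mult)

lemma conj_nat_pow:
  assumes "g \<in> carrier G" "x \<in> carrier G"
  shows "(g \<otimes> x \<otimes> inv g) [^] (n::nat) = g \<otimes> x [^] n \<otimes> inv g"
proof (induction n)
  case 0 then show ?case using assms by simp
next
  case (Suc n)
  then show ?case using assms by (simp add: m_assoc cancel_inv_left)
qed

lemma ord_conj:
  assumes "g \<in> carrier G" "x \<in> carrier G"
  shows "ord (g \<otimes> x \<otimes> inv g) = ord x"
proof -
  have "(g \<otimes> x \<otimes> inv g) [^] n = \<one> \<longleftrightarrow> x [^] n = \<one>" for n :: nat
  proof -
    have "g \<otimes> x [^] n \<otimes> inv g = g \<otimes> \<one> \<otimes> inv g \<longleftrightarrow> x [^] n = \<one>"
      using assms conjugation_is_inj[of g "x [^] n" \<one>] by auto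
    then show ?thesis using assms by (simp add: conj_nat_pow)
  qed
  then show ?thesis using assms ord_unique[of "g \<otimes> x \<otimes> inv g" "ord x"] pow_eq_id[of x] by auto
qed

lemma subgroup_centralizer:
  assumes "z \<in> carrier G"
  shows "subgroup (centralizer G z) G"
proof (rule subgroupI)
  show "centralizer G z \<subseteq> carrier G" by (auto simp: centralizer_def)
  show "centralizer G z \<noteq> {}" using assms by (auto simp: centralizer_def)
next
  fix a assume "a \<in> centralizer G z"
  then have a: "a \<in> carrier G" "a \<otimes> z = z \<otimes> a" by (auto simp: centralizer_def)
  have "inv a \<otimes> z = z \<otimes> inv a"
    by (metis a assms inv_closed inv_solve_left inv_solve_right' m_assoc m_closed)
  then show "inv a \<in> centralizer G z" using a by (auto simp: centralizer_def)
next
  fix a b assume "a \<in> centralizer G z" "b \<in> centralizer G z"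
  then show "a \<otimes> b \<in> centralizer G z" using assms
    by (simp add: centralizer_def) (metis m_assoc)
qed

text \<open>
  For coprime \<open>m\<close> and \<open>n\<close>, each solution of \<open>x\<^bsup>mn\<^esup> = 1\<close> is in exactly one way a product
  \<open>y z\<close> of commuting elements with \<open>y\<^sup>m = 1\<close> and \<open>z\<^sup>n = 1\<close>: both factors are powers of \<open>x\<close>,
  with exponents given by the Chinese remainder theorem. The sum collects the pairs by \<open>z\<close>.\<close>

lemma card_roots_mult_coprime:
  assumes fin: "finite (carrier G)" and cop: "coprime m n"
  shows "card (roots G (m * n)) =
    (\<Sum>z \<in> roots G n. card (roots (G\<lparr>carrier := centralizer G z\<rparr>) m))"
proof -
  obtain e where e: "[e = 1] (mod m)" "[e = 0] (mod n)"
    using binary_chinese_remainder_nat[OF cop] by blast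
  obtain f where f: "[f = 0] (mod m)" "[f = 1] (mod n)"
    using binary_chinese_remainder_nat[OF cop] by blast
  let ?S = "SIGMA z : roots G n. roots (G\<lparr>carrier := centralizer G z\<rparr>) m"
  have S: "(z, y) \<in> ?S \<longleftrightarrow> z \<in> carrier G \<and> y \<in> carrier G \<and> z [^] n = \<one> \<and> y [^] m = \<one> \<and> y \<otimes> z = z \<otimes> y"
    for z y
    by (auto simp: roots_def centralizer_def nat_pow_consistent[symmetric])
  have bij: "bij_betw (\<lambda>(z, y). y \<otimes> z) ?S (roots G (m * n))"
  proof (rule bij_betw_byWitness[where f' = "\<lambda>x. (x [^] f, x [^] e)"])
    have "(y \<otimes> z) [^] f = z \<and> (y \<otimes> z) [^] e = y" if "(z, y) \<in> ?S" for z y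
    proof -
      from that have zy: "z \<in> carrier G" "y \<in> carrier G" "z [^] n = \<one>" "y [^] m = \<one>" "y \<otimes> z = z \<otimes> y"
        unfolding S by auto
      have "(y \<otimes> z) [^] k = y [^] k \<otimes> z [^] k" for k :: nat
        using zy by (intro pow_mult_distrib) auto
      moreover have "y [^] f = \<one>" "y [^] e = y" "z [^] f = z" "z [^] e = \<one>"
        using pow_eq_if_cong[OF zy(2,4)] pow_eq_if_cong[OF zy(1,3)] e f zy
        by (metis nat_pow_0, metis nat_pow_eone, metis nat_pow_eone, metis nat_pow_0)
      ultimately show ?thesis using zy by simp
    qed
    then show "\<forall>a\<in>?S. ((case a of (z, y) \<Rightarrow> y \<otimes> z) [^] f, (case a of (z, y) \<Rightarrow> y \<otimes> z) [^] e) = a"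
      by auto
  next
    have "x [^] e \<otimes> x [^] f = x" if "x \<in> roots G (m * n)" for x
    proof -
      have x: "x \<in> carrier G" "x [^] (m * n) = \<one>" using that by (auto simp: roots_def)
      have "[e + f = 1] (mod m)" "[e + f = 1] (mod n)"
        using e f cong_add[of e 1 m f 0] cong_add[of e 0 n f 1] by simp_all
      then have "[e + f = 1] (mod m * n)" using cop by (simp add: coprime_cong_mult_nat)
      then show ?thesis using pow_eq_if_cong[OF x] x by (metis nat_pow_eone nat_pow_mult)
    qed
    then show "\<forall>x\<in>roots G (m * n). (case (x [^] f, x [^] e) of (z, y) \<Rightarrow> y \<otimes> z) = x" by simp
  next
    have "(y \<otimes> z) [^] (m * n) = \<one>" if "(z, y) \<in> ?S" for z y
    proof -
      from that have zy: "z \<in> carrier G" "y \<in> carrier G" "z [^] n = \<one>" "y [^] m = \<one>" "y \<otimes> z = z \<otimes> y"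
        unfolding S by auto
      have "(y \<otimes> z) [^] (m * n) = y [^] (m * n) \<otimes> z [^] (m * n)"
        using zy by (intro pow_mult_distrib) auto
      also have "y [^] (m * n) = \<one>" using zy by (metis nat_pow_pow nat_pow_one)
      also have "z [^] (m * n) = \<one>" using zy by (metis mult.commute nat_pow_pow nat_pow_one)
      finally show ?thesis by simp
    qed
    then show "(\<lambda>(z, y). y \<otimes> z) ` ?S \<subseteq> roots G (m * n)"
      by (auto simp: roots_def centralizer_def S)
  next
    have "(x [^] f, x [^] e) \<in> ?S" if "x \<in> roots G (m * n)" for x
    proof -
      have x: "x \<in> carrier G" "x [^] (m * n) = \<one>" using that by (auto simp: roots_def)
      have "[f * n = 0] (mod m * n)" "[e * m = 0] (mod m * n)"
        using e f by (auto simp: cong_0_iff mult_dvd_mono mult.commute)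
      then have "x [^] (f * n) = \<one>" "x [^] (e * m) = \<one>"
        using pow_eq_if_cong[OF x, of _ 0] by auto
      then show ?thesis unfolding S using x
        by (simp add: nat_pow_pow nat_pow_mult add.commute)
    qed
    then show "(\<lambda>x. (x [^] f, x [^] e)) ` roots G (m * n) \<subseteq> ?S" by auto
  qed
  have "finite (roots G n)" using fin by (simp add: roots_def)
  moreover have "finite (roots (G\<lparr>carrier := centralizer G z\<rparr>) m)" for z
    using fin by (simp add: roots_def centralizer_def)
  ultimately have "card ?S = (\<Sum>z \<in> roots G n. card (roots (G\<lparr>carrier := centralizer G z\<rparr>) m))"
    by simp
  then show ?thesis using bij_betw_same_card[OF bij] by simp
qed

lemma card_roots_centralizer_conj:
  assumes "g \<in> carrier G" "z \<in> carrier G"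
  shows "card (roots (G\<lparr>carrier := centralizer G (g \<otimes> z \<otimes> inv g)\<rparr>) m)
    = card (roots (G\<lparr>carrier := centralizer G z\<rparr>) m)"
proof -
  have *: "roots (G\<lparr>carrier := centralizer G z\<rparr>) m
     = {y \<in> carrier G. y [^] m = \<one> \<and> y \<otimes> z = z \<otimes> y}" for z
    by (auto simp: roots_def centralizer_def nat_pow_consistent[symmetric])
  have sub: "(\<lambda>y. h \<otimes> y \<otimes> inv h) ` {y \<in> carrier G. y [^] m = \<one> \<and> y \<otimes> z = z \<otimes> y} \<subseteq>
     {y \<in> carrier G. y [^] m = \<one> \<and> y \<otimes> (h \<otimes> z \<otimes> inv h) = (h \<otimes> z \<otimes> inv h) \<otimes> y}"
    if "h \<in> carrier G" "z \<in> carrier G" for h z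
    using that by (auto simp: conj_nat_pow conj_mult)
  have unconj1: "inv g \<otimes> (g \<otimes> z \<otimes> inv g) \<otimes> inv (inv g) = z" if "z \<in> carrier G" for z
    using assms(1) that by (simp add: m_assoc cancel_inv_left)
  have unconj2: "g \<otimes> (inv g \<otimes> z \<otimes> inv (inv g)) \<otimes> inv g = z" if "z \<in> carrier G" for z
    using assms(1) that by (simp add: m_assoc cancel_inv_left)
  have "bij_betw (\<lambda>y. g \<otimes> y \<otimes> inv g) (roots (G\<lparr>carrier := centralizer G z\<rparr>) m)
     (roots (G\<lparr>carrier := centralizer G (g \<otimes> z \<otimes> inv g)\<rparr>) m)"
    unfolding *
    apply (rule bij_betw_byWitness[where f' = "\<lambda>y. inv g \<otimes> y \<otimes> inv (inv g)"])
    subgoal using unconj1 by blast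
    subgoal using unconj2 by blast
    subgoal using sub assms by blast
    subgoal using sub[of "inv g" "g \<otimes> z \<otimes> inv g"] unconj1[OF assms(2)] assms by auto
    done
  then show ?thesis by (simp add: bij_betw_same_card)
qed

text \<open>
  A class function contributes \<open>|G : C(z)| f(z)\<close> on the class of \<open>z\<close>, so divisibility can be
  checked one class at a time.\<close>

lemma dvd_sum_class_function:
  fixes f :: "'a \<Rightarrow> nat"
  assumes fin: "finite (carrier G)"
    and inv: "\<And>g z. g \<in> carrier G \<Longrightarrow> z \<in> carrier G \<Longrightarrow> f (g \<otimes> z \<otimes> inv g) = f z"
    and dvd: "\<And>z j. z \<in> carrier G \<Longrightarrow> order G = j * card (centralizer G z) \<Longrightarrow> d dvd j * f z"
  shows "d dvd (\<Sum>z\<in>carrier G. f z)"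
proof -
  let ?\<phi> = "\<lambda>g. \<lambda>h\<in>carrier G. g \<otimes> h \<otimes> inv g"
  interpret C: group_action G "carrier G" ?\<phi> by (rule action_by_conjugation)
  have stab: "stabilizer G ?\<phi> z = centralizer G z" if "z \<in> carrier G" for z
    using that by (auto simp: stabilizer_def centralizer_def inv_solve_right')
  have "d dvd (\<Sum>x\<in>orb. f x)" if orb: "orb \<in> orbits G (carrier G) ?\<phi>" for orb
  proof -
    obtain z where z: "z \<in> carrier G" "orb = Group_Action.orbit G ?\<phi> z" using orb unfolding orbits_def by blast
    have "(\<Sum>x\<in>orb. f x) = (\<Sum>x\<in>orb. f z)"
      using z inv by (intro sum.cong) (auto simp: Group_Action.orbit_def)
    moreover have "order G = card orb * card (centralizer G z)"
      using C.orbit_stabilizer_theorem[OF z(1)] stab[OF z(1)] z(2) by simp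
    ultimately show ?thesis using dvd[OF z(1)] by simp
  qed
  then show ?thesis using C.disjoint_sum[OF fin, of f] by (metis (no_types, lifting) dvd_sum)
qed

text \<open>
  \<open>S\<close> is closed under passing from \<open>x\<close> to another generator of \<open>\<langle>x\<rangle>\<close>, so it is a disjoint
  union of sets of generators of cyclic subgroups, and \<open>\<langle>x\<rangle>\<close> has \<open>\<phi>(ord x)\<close> generators.\<close>

lemma dvd_card_if_dvd_totient_ord:
  assumes fin: "finite (carrier G)" and S: "S \<subseteq> carrier G"
    and closed: "\<And>x k. x \<in> S \<Longrightarrow> coprime k (ord x) \<Longrightarrow> x [^] (k::nat) \<in> S"
    and dvd: "\<And>x. x \<in> S \<Longrightarrow> d dvd totient (ord x)"
  shows "d dvd card S"
proof -
  define T where "T x = (\<lambda>k. x [^] k) ` totatives (ord x)" for x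
  have cardT: "card (T x) = totient (ord x)" if "x \<in> carrier G" for x
  proof -
    have "inj_on (\<lambda>k. x [^] k) (totatives (ord x))"
      using ord_inj'[OF that] by (rule inj_on_subset) (auto simp: totatives_def)
    then show ?thesis by (simp add: T_def card_image totient_def)
  qed
  have powT: "x [^] k \<in> T x" if "x \<in> carrier G" "coprime k (ord x)" for x and k :: nat
  proof (cases "ord x = 1")
    case True
    then have "x = \<one>" using ord_eq_1 that by blast
    then show ?thesis using True by (simp add: T_def)
  next
    case False
    have "ord x \<ge> 1" using ord_ge_1 fin that by blast
    then have "k mod ord x \<in> totatives (ord x)" using that False
      by (auto simp: totatives_def intro!: Nat.gr0I)
    moreover have "x [^] k = x [^] (k mod ord x)"
      by (rule pow_eq_if_cong[OF that(1) pow_ord_eq_1[OF that(1)]]) (simp add: cong_def)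
    ultimately show ?thesis by (simp add: T_def)
  qed
  have selfT: "x \<in> T x" if "x \<in> carrier G" for x
    using powT[OF that, of 1] that by simp
  have T_carr: "T x \<subseteq> carrier G" if "x \<in> carrier G" for x using that by (auto simp: T_def)
  have T_eq: "T y = T x" if xy: "x \<in> carrier G" "y \<in> T x" for x y
  proof -
    obtain k where k: "y = x [^] k" "coprime k (ord x)" using xy unfolding T_def totatives_def by blast
    have oy: "ord y = ord x" using k pow_ord_eq_ord_iff[OF fin that(1)] by simp
    have "T y \<subseteq> T x"
    proof
      fix w assume "w \<in> T y"
      then obtain l where l: "w = y [^] l" "coprime l (ord x)" unfolding T_def totatives_def oy by blast
      then have "w = x [^] (k * l)" using k that by (simp add: nat_pow_pow)
      then show "w \<in> T x" using powT[OF that(1), of "k * l"] k l by simp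
    qed
    moreover have "card (T y) = card (T x)" using cardT that T_carr oy by (metis subsetD)
    moreover have "finite (T x)" by (simp add: T_def)
    ultimately show ?thesis using card_subset_eq by blast
  qed
  have U: "\<Union> (T ` S) = S"
  proof
    show "\<Union> (T ` S) \<subseteq> S" using closed by (auto simp: T_def totatives_def)
    show "S \<subseteq> \<Union> (T ` S)" using selfT S by blast
  qed
  have "d dvd card (\<Union> (T ` S))"
  proof (rule dvd_partition)
    show "finite (\<Union> (T ` S))" unfolding U using fin S finite_subset by blast
    show "\<forall>c\<in>T ` S. d dvd card c" using cardT dvd S by auto
    show "\<forall>c1\<in>T ` S. \<forall>c2\<in>T ` S. c1 \<noteq> c2 \<longrightarrow> c1 \<inter> c2 = {}"
      using T_eq S by blast
  qed
  then show ?thesis by (simp add: U)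
qed

end


section \<open>Frobenius' theorem on the number of solutions of \<open>x\<^sup>n = 1\<close>\<close>

lemma (in group) pow_card_subgroup:
  assumes "subgroup H G" "x \<in> H"
  shows "x [^] card H = \<one>"
proof -
  interpret H: group "G\<lparr>carrier := H\<rparr>" using assms subgroup_imp_group by blast
  show ?thesis using H.pow_order_eq_1[of x] assms by (simp add: order_def flip: nat_pow_consistent)
qed

lemma (in group) ord_dvd_card_subgroup:
  assumes "subgroup H G" "x \<in> H"
  shows "ord x dvd card H"
  using pow_card_subgroup[OF assms] pow_eq_id[OF subgroup.mem_carrier[OF assms]] by simp

lemma (in group) cauchy:
  assumes "finite (carrier G)" "Factorial_Ring.prime p" "p dvd order G"
  shows "\<exists>x\<in>carrier G. ord x = p"
proof -
  obtain m where "order G = p ^ 1 * m" using assms(3) by auto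
  then obtain H where H: "subgroup H G" "card H = p ^ 1"
    using sylow_thm[OF assms(2) is_group _ assms(1), of 1 m] by blast
  have "card H > 1" using H assms(2) prime_gt_1_nat by simp
  then have "\<not> H \<subseteq> {\<one>}" using card_mono[of "{\<one>}" H] by auto
  then obtain x where x: "x \<in> H" "x \<noteq> \<one>" by blast
  have xc: "x \<in> carrier G" using subgroup.mem_carrier[OF H(1) x(1)] .
  have "ord x dvd p" using ord_dvd_card_subgroup[OF H(1) x(1)] H(2) by simp
  moreover have "ord x \<noteq> 1" using x(2) ord_eq_1[OF xc] by simp
  ultimately have "ord x = p" using assms(2) by (auto simp: prime_nat_iff)
  then show ?thesis using xc by blast
qed

text \<open>
  The central solutions of \<open>x\<^sup>s = 1\<close> form a subgroup without elements of order \<open>p\<close>, so Cauchy's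
  theorem applies.\<close>

lemma (in group) coprime_card_central_roots:
  assumes fin: "finite (carrier G)" and p: "Factorial_Ring.prime p" "\<not> p dvd s"
  shows "coprime p (card (roots G s \<inter> center G))"
proof -
  let ?Z = "roots G s \<inter> center G"
  have Z: "subgroup ?Z G"
  proof (rule subgroupI)
    show "?Z \<subseteq> carrier G" by (auto simp: roots_def)
    have "\<one> \<in> ?Z" by (auto simp: roots_def center_def)
    then show "?Z \<noteq> {}" by blast
  next
    fix a assume "a \<in> ?Z"
    then have a: "a \<in> carrier G" "ord a dvd s" "\<And>g. g \<in> carrier G \<Longrightarrow> g \<otimes> a = a \<otimes> g"
      by (auto simp: roots_iff center_def)
    have "g \<otimes> inv a = inv a \<otimes> g" if "g \<in> carrier G" for g
      using a(3)[of "inv g"] a(1) that by (metis inv_closed inv_inv inv_mult_group)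
    then show "inv a \<in> ?Z" using a by (auto simp: roots_iff center_def)
  next
    fix a b assume "a \<in> ?Z" "b \<in> ?Z"
    then have a: "a \<in> carrier G" "a [^] s = \<one>" "\<And>g. g \<in> carrier G \<Longrightarrow> g \<otimes> a = a \<otimes> g"
      and b: "b \<in> carrier G" "b [^] s = \<one>" "\<And>g. g \<in> carrier G \<Longrightarrow> g \<otimes> b = b \<otimes> g"
      by (auto simp: roots_def center_def)
    have "g \<otimes> (a \<otimes> b) = (a \<otimes> b) \<otimes> g" if "g \<in> carrier G" for g
      using a b that by (metis m_assoc)
    moreover have "(a \<otimes> b) [^] s = \<one>"
      using pow_mult_distrib[OF b(3)[OF a(1)] a(1) b(1), of s] a(2) b(2) by simp
    ultimately show "a \<otimes> b \<in> ?Z" using a(1) b(1) by (auto simp: roots_def center_def)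
  qed
  have "\<not> p dvd card ?Z"
  proof
    assume "p dvd card ?Z"
    interpret Z: group "G\<lparr>carrier := ?Z\<rparr>" using Z subgroup_imp_group by blast
    have "finite (carrier (G\<lparr>carrier := ?Z\<rparr>))" using fin by (simp add: roots_def)
    then obtain x where x: "x \<in> ?Z" "Z.ord x = p"
      using Z.cauchy[OF _ p(1)] \<open>p dvd card ?Z\<close> by (auto simp: order_def)
    have "x [^]\<^bsub>G\<lparr>carrier := ?Z\<rparr>\<^esub> s = \<one>\<^bsub>G\<lparr>carrier := ?Z\<rparr>\<^esub>"
      using x by (simp add: roots_def flip: nat_pow_consistent)
    then have "p dvd s" using Z.pow_eq_id[of x s] x by simp
    with p show False by blast
  qed
  then show ?thesis using prime_imp_coprime[OF p(1)] by blast
qed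

text \<open>
  The orders of the elements counted here are exactly divisible by \<open>p\<^bsup>j+1\<^esup>\<close>, and
  \<open>\<phi>(p\<^bsup>j+1\<^esup>) = p\<^sup>j (p - 1)\<close> divides the totient of each of them.\<close>

lemma (in group) totient_dvd_card_roots_diff:
  assumes fin: "finite (carrier G)" and p: "Factorial_Ring.prime p" and m: "\<not> p dvd m"
  shows "p ^ j * (p - 1) dvd card (roots G (p ^ Suc j * m) - roots G (p ^ j * m))"
proof (rule dvd_card_if_dvd_totient_ord[OF fin])
  fix x k assume x: "x \<in> roots G (p ^ Suc j * m) - roots G (p ^ j * m)" and k: "coprime k (ord x)"
  then have "ord (x [^] k) = ord x" using pow_ord_eq_ord_iff[OF fin] by (simp add: roots_iff)
  then show "x [^] k \<in> roots G (p ^ Suc j * m) - roots G (p ^ j * m)"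
    using x by (simp add: roots_iff)
next
  fix x assume x: "x \<in> roots G (p ^ Suc j * m) - roots G (p ^ j * m)"
  then have "ord x dvd p ^ Suc j * m" "\<not> ord x dvd p ^ j * m" by (auto simp: roots_iff)
  have "ord x \<noteq> 0" using ord_ge_1[OF fin, of x] x by (simp add: roots_def)
  moreover have "\<not> is_unit p" using p not_prime_unit by blast
  ultimately obtain r where r: "ord x = p ^ multiplicity p (ord x) * r" "\<not> p dvd r"
    by (rule multiplicity_decompose')
  have "coprime r (p ^ Suc j)" using prime_imp_coprime[OF p r(2)] by (simp add: coprime_commute)
  moreover have "r dvd p ^ Suc j * m" using \<open>ord x dvd p ^ Suc j * m\<close> r(1) dvd_mult_right by metis
  ultimately have "r dvd m" using coprime_dvd_mult_right_iff by blast
  have "\<not> multiplicity p (ord x) \<le> j"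
  proof
    assume "multiplicity p (ord x) \<le> j"
    then have "ord x dvd p ^ j * m"
      using \<open>r dvd m\<close> by (subst r(1), intro mult_dvd_mono le_imp_power_dvd)
    with \<open>\<not> ord x dvd p ^ j * m\<close> show False by blast
  qed
  then have "p ^ Suc j dvd p ^ multiplicity p (ord x)" by (intro le_imp_power_dvd) simp
  then have "p ^ Suc j dvd ord x" using r(1) by (metis dvd_mult2)
  then have "totient (p ^ Suc j) dvd totient (ord x)" by (rule totient_dvd)
  then show "p ^ j * (p - 1) dvd totient (ord x)" using totient_prime_power_Suc[OF p, of j] by simp
qed (auto simp: roots_def)

text \<open>
  Induction step for Frobenius' theorem. Splitting the solutions \<open>x\<close> of \<open>x\<^bsup>p^j t\<^esup> = 1\<close> into
  commuting parts leaves a sum over the solutions \<open>z\<close> of \<open>z\<^sup>t = 1\<close>. A noncentral \<open>z\<close> has a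
  proper centralizer, for which the divisibility is assumed; together with the size of its class it
  contributes a multiple of \<open>p\<^sup>j\<close>. Modulo \<open>p\<^sup>j\<close> only the central \<open>z\<close> remain.\<close>

lemma (in group) dvd_card_roots_iff_central:
  assumes fin: "finite (carrier G)" and p: "Factorial_Ring.prime p"
    and j: "p ^ j dvd order G" and t: "\<not> p dvd t"
    and sub: "\<And>H. subgroup H G \<Longrightarrow> H \<noteq> carrier G \<Longrightarrow>
      gcd (p ^ j) (card H) dvd card (roots (G\<lparr>carrier := H\<rparr>) (p ^ j))"
  shows "p ^ j dvd card (roots G (p ^ j * t))
      \<longleftrightarrow> p ^ j dvd card (roots G t \<inter> center G) * card (roots G (p ^ j))"
proof -
  define F where "F z = card (roots (G\<lparr>carrier := centralizer G z\<rparr>) (p ^ j))" for z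
  define f where "f z = (if z \<in> roots G t - center G then F z else 0)" for z
  have cop: "coprime (p ^ j) t" using prime_imp_coprime[OF p t] by simp
  have ffin: "finite (roots G t)" using fin by (simp add: roots_def)
  have center: "F z = card (roots G (p ^ j))" if "z \<in> center G" for z
  proof -
    have "centralizer G z = carrier G" using that by (auto simp: centralizer_def center_def)
    then show ?thesis by (simp add: F_def)
  qed
  have "card (roots G (p ^ j * t)) = (\<Sum>z\<in>roots G t. F z)"
    using card_roots_mult_coprime[OF fin cop] by (simp add: F_def)
  also have "\<dots> = (\<Sum>z\<in>roots G t \<inter> center G. F z) + (\<Sum>z\<in>roots G t - center G. F z)"
    using ffin by (metis sum.Int_Diff)
  also have "(\<Sum>z\<in>roots G t \<inter> center G. F z)
      = card (roots G t \<inter> center G) * card (roots G (p ^ j))"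
    using center by simp
  also have "(\<Sum>z\<in>roots G t - center G. F z) = (\<Sum>z\<in>carrier G. f z)"
    unfolding f_def by (rule sum.mono_neutral_cong_left) (auto simp: fin roots_def)
  finally have eq: "card (roots G (p ^ j * t)) =
     card (roots G t \<inter> center G) * card (roots G (p ^ j)) + (\<Sum>z\<in>carrier G. f z)" .
  have "p ^ j dvd (\<Sum>z\<in>carrier G. f z)"
  proof (rule dvd_sum_class_function[OF fin])
    fix g z assume gz: "g \<in> carrier G" "z \<in> carrier G"
    have "g \<otimes> z \<otimes> inv g \<in> center G \<longleftrightarrow> z \<in> center G"
    proof -
      have *: "h \<otimes> w \<otimes> inv h = w" if "h \<in> carrier G" "w \<in> center G" for h w
        using that by (auto simp: center_def m_assoc)
      have "inv g \<otimes> (g \<otimes> z \<otimes> inv g) \<otimes> inv (inv g) = z"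
        using gz by (simp add: m_assoc cancel_inv_left)
      then show ?thesis using *[of g z] *[of "inv g" "g \<otimes> z \<otimes> inv g"] gz by auto
    qed
    moreover have "g \<otimes> z \<otimes> inv g \<in> roots G t \<longleftrightarrow> z \<in> roots G t"
      using gz by (simp add: roots_iff ord_conj)
    ultimately show "f (g \<otimes> z \<otimes> inv g) = f z"
      using card_roots_centralizer_conj[OF gz] by (simp add: f_def F_def)
  next
    fix z i assume z: "z \<in> carrier G" and i: "order G = i * card (centralizer G z)"
    show "p ^ j dvd i * f z"
    proof (cases "z \<in> roots G t - center G")
      case True
      then have "centralizer G z \<noteq> carrier G"
        using z by (auto simp: centralizer_def center_def)
      then have "gcd (p ^ j) (card (centralizer G z)) dvd F z"
        unfolding F_def using sub subgroup_centralizer[OF z] by blast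
      then have "i * gcd (p ^ j) (card (centralizer G z)) dvd i * F z" by simp
      moreover have "p ^ j dvd i * gcd (p ^ j) (card (centralizer G z))"
        using j unfolding i by (simp add: gcd_mult_distrib_nat)
      ultimately have "p ^ j dvd i * F z" by (rule dvd_trans[rotated])
      then show ?thesis using True by (simp add: f_def)
    qed (simp only: f_def, simp)
  qed
  then show ?thesis unfolding eq by (simp add: dvd_add_left_iff)
qed

text \<open>
  The preceding equivalence is used in both directions. For \<open>p\<^sup>v t = |G|\<close> with \<open>p\<close> not dividing
  \<open>t\<close>, all elements of \<open>G\<close> are solutions, so the left side holds, and because the number of
  central solutions is coprime to \<open>p\<close>, the claim follows for the exponent \<open>p\<^sup>v\<close> alone. From there
  it descends to all \<open>p\<^sup>j\<close>, since \<open>p\<^sup>j\<close> divides the number of elements of order \<open>p\<^bsup>j+1\<^esup>\<close>, and the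
  other direction returns to a general cofactor \<open>s\<close>.\<close>

lemma prime_power_dvd_card_roots:
  fixes G :: "('a, 'b) monoid_scheme"
  assumes "group G" "finite (carrier G)" "Factorial_Ring.prime p" "p ^ k dvd order G" "\<not> p dvd s"
  shows "p ^ k dvd card (roots G (p ^ k * s))"
  using assms
proof (induction "order G" arbitrary: G k s rule: less_induct)
  case less
  interpret group G by fact
  note fin = \<open>finite (carrier G)\<close> and p = \<open>Factorial_Ring.prime p\<close>
  have p1: "p > 1" using p prime_gt_1_nat by blast
  have sub: "gcd (p ^ j) (card H) dvd card (roots (G\<lparr>carrier := H\<rparr>) (p ^ j))"
    if H: "subgroup H G" "H \<noteq> carrier G" for H j
  proof -
    interpret H: group "G\<lparr>carrier := H\<rparr>" using H subgroup_imp_group by blast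
    have finH: "finite H" using fin H(1) subgroup.subset finite_subset by blast
    have "card H < order G" using H fin subgroup.subset[OF H(1)]
      by (simp add: order_def psubset_card_mono psubset_eq)
    obtain i where i: "gcd (p ^ j) (card H) = p ^ i"
      using divides_primepow_nat[OF p, of "gcd (p ^ j) (card H)" j] by auto
    have "p ^ i dvd card H" by (metis i gcd_dvd2)
    moreover have "\<not> p dvd 1" using p1 by simp
    ultimately have "p ^ i dvd card (roots (G\<lparr>carrier := H\<rparr>) (p ^ i * 1))"
      using \<open>card H < order G\<close> finH p H.is_group
      by (intro less.hyps) (simp_all add: order_def)
    moreover have "roots (G\<lparr>carrier := H\<rparr>) (p ^ i) = roots (G\<lparr>carrier := H\<rparr>) (p ^ j)"
    proof -
      have "roots (G\<lparr>carrier := H\<rparr>) (p ^ i)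
          = roots (G\<lparr>carrier := H\<rparr>) (p ^ j) \<inter> roots (G\<lparr>carrier := H\<rparr>) (order (G\<lparr>carrier := H\<rparr>))"
        by (simp add: H.roots_gcd order_def i)
      also have "\<dots> = roots (G\<lparr>carrier := H\<rparr>) (p ^ j)"
        by (subst H.roots_order) (auto simp: roots_def)
      finally show ?thesis .
    qed
    ultimately show ?thesis by (simp add: i)
  qed
  have red: "p ^ j dvd card (roots G (p ^ j * t))
      \<longleftrightarrow> p ^ j dvd card (roots G t \<inter> center G) * card (roots G (p ^ j))"
    if "p ^ j dvd order G" "\<not> p dvd t" for j t
    by (rule dvd_card_roots_iff_central[OF fin p that sub])
  have n0: "order G \<noteq> 0" using fin order_gt_0_iff_finite by auto
  define v where "v = multiplicity p (order G)"
  obtain t where t: "order G = p ^ v * t" "\<not> p dvd t"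
    unfolding v_def using n0 p multiplicity_decompose' by (metis not_prime_unit)
  have ppow: "p ^ j dvd card (roots G (p ^ j))" if "j \<le> v" for j
    using that
  proof (induction rule: inc_induct)
    case base
    have "p ^ v dvd card (roots G (p ^ v * t))"
      using roots_order t(1) by (simp add: order_def)
    then have "p ^ v dvd card (roots G t \<inter> center G) * card (roots G (p ^ v))"
      using red[of v t] t by simp
    moreover have "coprime (p ^ v) (card (roots G t \<inter> center G))"
      using coprime_card_central_roots[OF fin p t(2)] by simp
    ultimately show ?case using coprime_dvd_mult_right_iff by blast
  next
    case (step j)
    have "p ^ j dvd card (roots G (p ^ Suc j) - roots G (p ^ j))"
      using totient_dvd_card_roots_diff[OF fin p, of 1 j] p1 by (auto dest: dvd_mult_left)
    moreover have "p ^ j dvd card (roots G (p ^ Suc j))"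
      using step.IH by (rule dvd_trans[rotated]) (simp add: le_imp_power_dvd)
    moreover have "roots G (p ^ j) \<subseteq> roots G (p ^ Suc j)" by (auto simp: roots_iff)
    moreover have "finite (roots G (p ^ Suc j))" using fin by (simp add: roots_def)
    ultimately have "p ^ j dvd card (roots G (p ^ Suc j)) - card (roots G (p ^ Suc j) - roots G (p ^ j))"
      and "card (roots G (p ^ Suc j) - roots G (p ^ j)) = card (roots G (p ^ Suc j)) - card (roots G (p ^ j))"
      and "card (roots G (p ^ j)) \<le> card (roots G (p ^ Suc j))"
      by (auto intro: dvd_diff_nat card_Diff_subset card_mono dest: finite_subset)
    then show ?case by simp
  qed
  have "k \<le> v" unfolding v_def 
    using \<open>p ^ k dvd order G\<close> n0 p not_prime_unit by (intro multiplicity_geI) auto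
  then show ?case using red[OF \<open>p ^ k dvd order G\<close> \<open>\<not> p dvd s\<close>] ppow by simp
qed

text \<open>It suffices to consider the prime powers that exactly divide \<open>n\<close>.\<close>

theorem (in group) frobenius_dvd_card_roots:
  assumes fin: "finite (carrier G)" and n: "n dvd order G"
  shows "n dvd card (roots G n)"
proof (rule multiplicity_le_imp_dvd)
  have "order G \<noteq> 0" using fin order_gt_0_iff_finite by auto
  then have n0: "n \<noteq> 0" using n by auto
  then show "n \<noteq> 0" .
  fix p :: nat assume p: "Factorial_Ring.prime p"
  define v where "v = multiplicity p n"
  obtain t where t: "n = p ^ v * t" "\<not> p dvd t"
    unfolding v_def using n0 p multiplicity_decompose' by (metis not_prime_unit)
  have "p ^ v dvd card (roots G (p ^ v * t))"
    using t n dvd_trans[of "p ^ v" n "order G"]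
    by (intro prime_power_dvd_card_roots[OF is_group fin p]) simp_all
  moreover have "card (roots G n) \<noteq> 0"
  proof -
    have "\<one> \<in> roots G n" by (simp add: roots_def)
    moreover have "finite (roots G n)" using fin by (simp add: roots_def)
    ultimately show ?thesis by auto
  qed
  ultimately show "multiplicity p n \<le> multiplicity p (card (roots G n))"
    using t(1) p not_prime_unit by (fold v_def, intro multiplicity_geI) auto
qed


section \<open>Counting when the Sylow subgroups are cyclic\<close>

text \<open>For \<open>n > 0\<close>, the largest divisor of \<open>n\<close> all of whose prime factors are at least \<open>q\<close>.\<close>

definition large_part :: "nat \<Rightarrow> nat \<Rightarrow> nat" where
  "large_part q n = (\<Prod>p | p \<in> prime_factors n \<and> q \<le> p. p ^ multiplicity p n)"

lemma large_part_0: "n > 0 \<Longrightarrow> large_part 0 n = n"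
  by (simp add: large_part_def flip: prime_factorization_nat)

lemma large_part_top: "n > 0 \<Longrightarrow> n < q \<Longrightarrow> large_part q n = 1"
proof -
  assume n: "n > 0" "n < q"
  then have none: "{p. p \<in> prime_factors n \<and> q \<le> p} = {}"
    by (auto simp: in_prime_factors_iff dest!: dvd_imp_le)
  show ?thesis unfolding large_part_def none by simp
qed

lemma large_part_step:
  assumes "Factorial_Ring.prime q" "n > 0"
  shows "large_part q n = q ^ multiplicity q n * large_part (Suc q) n"
proof (cases "q dvd n")
  case True
  have "{p. p \<in> prime_factors n \<and> q \<le> p} = insert q {p. p \<in> prime_factors n \<and> Suc q \<le> p}"
    using assms True by (auto simp: in_prime_factors_iff)
  then show ?thesis by (simp add: large_part_def)
next
  case False
  then have "{p. p \<in> prime_factors n \<and> q \<le> p} = {p. p \<in> prime_factors n \<and> Suc q \<le> p}"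
    by (auto simp: in_prime_factors_iff Suc_le_eq le_less)
  then show ?thesis using False by (simp add: large_part_def not_dvd_imp_multiplicity_0)
qed

lemma large_part_step_nonprime:
  assumes "\<not> Factorial_Ring.prime q"
  shows "large_part q n = large_part (Suc q) n"
proof -
  have "{p. p \<in> prime_factors n \<and> q \<le> p} = {p. p \<in> prime_factors n \<and> Suc q \<le> p}"
    using assms by (auto simp: in_prime_factors_iff Suc_le_eq le_less)
  then show ?thesis by (simp add: large_part_def)
qed

lemma prime_dvd_large_part:
  assumes "Factorial_Ring.prime r" "r dvd large_part q n"
  shows "q \<le> r"
proof -
  obtain p where p: "p \<in> prime_factors n" "q \<le> p" "r dvd p ^ multiplicity p n"
    using assms prime_dvd_prod_iff[of "{p. p \<in> prime_factors n \<and> q \<le> p}" r "\<lambda>p. p ^ multiplicity p n"]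
    by (auto simp: large_part_def)
  then have "r dvd p" using assms(1) prime_dvd_power by blast
  then have "r = p" using primes_dvd_imp_eq[of r p] p(1) assms(1) by (simp add: in_prime_factors_iff)
  then show ?thesis using p(2) by simp
qed

lemma large_part_dvd:
  assumes "n > 0"
  shows "large_part q n dvd n"
proof -
  have "large_part q n dvd (\<Prod>p\<in>prime_factors n. p ^ multiplicity p n)"
    unfolding large_part_def by (intro prod_dvd_prod_subset) auto
  then show ?thesis using prime_factorization_nat assms by simp
qed

text \<open>
  For finite groups, an elementwise form of the condition that there is a cyclic Sylow
  \<open>p\<close>-subgroup for every prime \<open>p\<close>. In this form it passes to normal subgroups and to quotients
  without Sylow's conjugacy theorem.\<close>

definition cyclic_sylows :: "('a, 'b) monoid_scheme \<Rightarrow> bool" where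
  "cyclic_sylows G \<longleftrightarrow> (\<forall>p. Factorial_Ring.prime p \<longrightarrow>
     (\<exists>y\<in>carrier G. group.ord G y = p ^ multiplicity p (order G)))"

text \<open>
  One factor \<open>p\<close> is removed at a time. If \<open>x\<^bsup>pn\<^esup> = 1\<close> has exactly \<open>pn\<close> solutions, then by
  Frobenius \<open>x\<^sup>n = 1\<close> has \<open>nk\<close> solutions, and \<open>1 \<le> k < p\<close> because a power of \<open>y\<close> solves only the
  former equation. The number \<open>n(p - k)\<close> of the other elements is divisible by \<open>p - 1\<close>. As no
  prime below \<open>p\<close> divides \<open>n\<close>, \<open>p - 1\<close> is coprime to \<open>n\<close>, hence it divides \<open>p - k\<close>, and \<open>k = 1\<close>.\<close>

lemma (in group) card_roots_remove_smallest_prime: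
  assumes fin: "finite (carrier G)" and p: "Factorial_Ring.prime p" and m: "\<not> p dvd m"
    and small: "\<And>r. Factorial_Ring.prime r \<Longrightarrow> r dvd m \<Longrightarrow> p \<le> r"
    and dvd: "p ^ v * m dvd order G" and all: "card (roots G (p ^ v * m)) = p ^ v * m"
    and y: "y \<in> carrier G" "ord y = p ^ v" and "j \<le> v"
  shows "card (roots G (p ^ j * m)) = p ^ j * m"
  using \<open>j \<le> v\<close>
proof (induction rule: inc_induct)
  case base
  show ?case by (rule all)
next
  case (step j)
  define n where "n = p ^ j * m"
  have pn: "p ^ Suc j * m = p * n" by (simp add: n_def)
  have finr: "finite (roots G k)" for k using fin by (simp add: roots_def)
  have p1: "p > 1" using p prime_gt_1_nat by blast
  have n0: "n > 0" using dvd fin order_gt_0_iff_finite p1 by (auto simp: n_def intro!: Nat.gr0I)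
  have sub: "roots G n \<subseteq> roots G (p * n)" by (auto simp: roots_iff)
  have IH: "card (roots G (p * n)) = p * n" using step.IH pn by metis
  have "n dvd order G"
    using dvd \<open>j < v\<close> by (intro dvd_trans[OF _ dvd]) (simp add: n_def le_imp_power_dvd mult_dvd_mono)
  then obtain k where k: "card (roots G n) = n * k"
    using frobenius_dvd_card_roots[OF fin] by blast
  have "\<one> \<in> roots G n" by (simp add: roots_def)
  then have "card (roots G n) > 0" using finr card_gt_0_iff by blast
  then have k0: "k \<ge> 1" using k by (auto intro!: Nat.gr0I)
  have "y [^] (p ^ (v - Suc j)) \<in> roots G (p * n) - roots G n"
  proof -
    have "p ^ v div p ^ (v - Suc j) = p ^ Suc j"
      using \<open>j < v\<close> p1 by (subst power_diff[symmetric]) auto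
    then have o: "ord (y [^] (p ^ (v - Suc j))) = p ^ Suc j"
      using ord_pow[OF y(1), of "p ^ (v - Suc j)"] y(2) p1 by (simp add: le_imp_power_dvd)
    have "\<not> p ^ Suc j dvd n"
      using m p1 dvd_mult_cancel1[of "p ^ j" p] by (simp add: n_def power_Suc2 del: power_Suc)
    moreover have "p ^ Suc j dvd p * n" by (simp add: n_def)
    ultimately show ?thesis using o y(1) by (simp add: roots_iff)
  qed
  then have "roots G n \<noteq> roots G (p * n)" by blast
  then have "card (roots G n) < card (roots G (p * n))"
    using sub finr by (simp add: psubset_card_mono psubset_eq)
  then have kp: "k < p" using IH k n0 by (simp add: mult.commute)
  have "p ^ j * (p - 1) dvd card (roots G (p * n) - roots G n)"
    using totient_dvd_card_roots_diff[OF fin p m, of j] unfolding pn n_def[symmetric] .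
  then have "p - 1 dvd card (roots G (p * n) - roots G n)" by (rule dvd_mult_right)
  also have "card (roots G (p * n) - roots G n) = p * n - n * k"
    using card_Diff_subset[OF finr sub] IH k by simp
  also have "\<dots> = n * (p - k)" by (simp add: diff_mult_distrib2 mult.commute)
  finally have "p - 1 dvd n * (p - k)" .
  moreover have "coprime (p - 1) n"
  proof (rule ccontr)
    assume "\<not> coprime (p - 1) n"
    then have "gcd (p - 1) n \<noteq> 1" using coprime_iff_gcd_eq_1 by blast
    then obtain r where r: "Factorial_Ring.prime r" "r dvd gcd (p - 1) n"
      using prime_factor_nat by blast
    then have "r dvd p - 1" "r dvd p ^ j * m" by (auto simp: n_def)
    then have "r \<le> p - 1" using p1 by (intro dvd_imp_le) auto
    moreover have "p \<le> r"
    proof (cases "r dvd m")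
      case True then show ?thesis using small r by blast
    next
      case False
      then have "r dvd p ^ j" using r(1) \<open>r dvd p ^ j * m\<close> prime_dvd_mult_iff by blast
      then have "r dvd p" using r(1) prime_dvd_power by blast
      then show ?thesis using primes_dvd_imp_eq[OF r(1) p] by simp
    qed
    ultimately show False using p1 by linarith
  qed
  ultimately have "p - 1 dvd p - k" using coprime_dvd_mult_right_iff by blast
  then have "p - 1 \<le> p - k" using kp by (intro dvd_imp_le) auto
  then have "k = 1" using k0 kp by linarith
  then show ?case using k by (simp add: n_def)
qed

theorem (in group) card_roots_large_part:
  assumes fin: "finite (carrier G)" and cyc: "cyclic_sylows G"
  shows "card (roots G (large_part q (order G))) = large_part q (order G)"
proof (induction q)
  case 0
  show ?case using fin order_gt_0_iff_finite roots_order by (simp add: large_part_0 order_def)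
next
  case (Suc q)
  have pos: "order G > 0" using fin order_gt_0_iff_finite by blast
  show ?case
  proof (cases "Factorial_Ring.prime q")
    case False
    then show ?thesis using Suc by (simp add: large_part_step_nonprime)
  next
    case True
    obtain y where y: "y \<in> carrier G" "ord y = q ^ multiplicity q (order G)"
      using cyc True by (auto simp: cyclic_sylows_def)
    have eq: "large_part q (order G) = q ^ multiplicity q (order G) * large_part (Suc q) (order G)"
      using large_part_step[OF True pos] .
    have "card (roots G (q ^ 0 * large_part (Suc q) (order G))) = q ^ 0 * large_part (Suc q) (order G)"
    proof (rule card_roots_remove_smallest_prime[OF fin True _ _ _ _ y])
      show "\<not> q dvd large_part (Suc q) (order G)"
        using prime_dvd_large_part[OF True, of "Suc q"] by auto
      show "q \<le> r" if "Factorial_Ring.prime r" "r dvd large_part (Suc q) (order G)" for r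
        using prime_dvd_large_part[OF that] by simp
      show "q ^ multiplicity q (order G) * large_part (Suc q) (order G) dvd order G"
        using large_part_dvd[OF pos] eq by metis
      show "card (roots G (q ^ multiplicity q (order G) * large_part (Suc q) (order G))) =
          q ^ multiplicity q (order G) * large_part (Suc q) (order G)"
        using Suc eq by metis
    qed simp
    then show ?thesis by simp
  qed
qed


section \<open>A normal series and a self-centralizing abelian normal subgroup\<close>

lemma primepow_gcd_total:
  fixes q :: nat
  assumes q: "Factorial_Ring.prime q"
  shows "gcd i (q ^ v) dvd gcd j (q ^ v) \<or> gcd j (q ^ v) dvd gcd i (q ^ v)"
proof -
  obtain a b where "gcd i (q ^ v) = q ^ a" "gcd j (q ^ v) = q ^ b"
    using divides_primepow_nat[OF q, of "gcd i (q ^ v)" v] divides_primepow_nat[OF q, of "gcd j (q ^ v)" v]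
    by auto
  then show ?thesis using le_imp_power_dvd[of a b q] le_imp_power_dvd[of b a q] by (metis nat_le_linear)
qed

context group
begin

lemma nat_pow_mem_subgroup:
  assumes "subgroup H G" "x \<in> H"
  shows "x [^] (n::nat) \<in> H"
  using assms by (induction n) (auto simp: subgroup.one_closed subgroup.m_closed)

lemma roots_conj_closed:
  assumes "g \<in> carrier G" "x \<in> roots G n"
  shows "g \<otimes> x \<otimes> inv g \<in> roots G n"
  using assms by (simp add: roots_iff ord_conj)

lemma normal_roots:
  assumes "subgroup (roots G n) G"
  shows "roots G n \<lhd> G"
  using assms roots_conj_closed by (simp add: normal_inv_iff)

text \<open>Both sides have the same image in \<open>G / N\<close>.\<close>

lemma pow_mult_mem_coset:
  assumes N: "N \<lhd> G" and u: "u \<in> N" and b: "b \<in> carrier G"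
  shows "\<exists>w\<in>N. (u \<otimes> b) [^] (k::nat) = w \<otimes> b [^] k"
proof -
  interpret N: normal N G by fact
  have uc: "u \<in> carrier G" using u N.mem_carrier by blast
  have "N #> (u \<otimes> b) = N #> b"
    using u b uc coset_mult_assoc[OF N.subset uc b] coset_join2[OF uc N.subgroup_axioms u] by simp
  then have "N #> ((u \<otimes> b) [^] k) = N #> (b [^] k)"
    using N.FactGroup_pow[of "u \<otimes> b" k] N.FactGroup_pow[of b k] uc b by simp
  then have "(u \<otimes> b) [^] k \<in> N #> (b [^] k)"
    using rcos_self[of "(u \<otimes> b) [^] k" N] N.subgroup_axioms uc b by simp
  then show ?thesis by (auto simp: r_coset_def)
qed

lemma eq_one_if_mem_coprime_subgroups:
  assumes H: "subgroup H G" and K: "subgroup K G" and cop: "coprime (card H) (card K)"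
    and x: "x \<in> H" "x \<in> K"
  shows "x = \<one>"
proof -
  have "ord x = 1"
    using ord_dvd_card_subgroup[OF H x(1)] ord_dvd_card_subgroup[OF K x(2)] cop
    by (metis coprime_common_divisor_nat)
  then show ?thesis using ord_eq_1[OF subgroup.mem_carrier[OF H x(1)]] by simp
qed

lemma card_set_mult_coprime:
  assumes H: "subgroup H G" and K: "subgroup K G" and cop: "coprime (card H) (card K)"
  shows "card (H <#> K) = card H * card K"
proof -
  have HK: "H \<inter> K \<subseteq> {\<one>}"
    using eq_one_if_mem_coprime_subgroups[OF H K cop] by blast
  interpret group_disjoint_sum G H K
    by (simp add: group_disjoint_sum_def H K is_group)
  have "inj_on (\<lambda>(h, k). h \<otimes> k) (H \<times> K)"
    using HK unfolding cancel by (auto simp: inj_on_def)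
  moreover have "H <#> K = (\<lambda>(h, k). h \<otimes> k) ` (H \<times> K)"
    by (auto simp: set_mult_def)
  ultimately show ?thesis by (simp add: card_image card_cartesian_product)
qed

text \<open>Multiplying the previous term of the series by a cyclic Sylow \<open>q\<close>-subgroup gives a subgroup
  whose order is that of the next term. Its elements are solutions by Lagrange, and there
  are no further solutions by the count.\<close>

lemma roots_large_part_step:
  assumes fin: "finite (carrier G)" and cyc: "cyclic_sylows G" and q: "Factorial_Ring.prime q"
    and U: "subgroup (roots G (large_part (Suc q) (order G))) G"
  shows "\<exists>y v. y \<in> carrier G \<and> ord y = q ^ v \<and> subgroup (roots G (large_part q (order G))) G \<and>
    roots G (large_part q (order G)) = roots G (large_part (Suc q) (order G)) <#> generate G {y}"
proof -
  define v where "v = multiplicity q (order G)"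
  obtain y where y: "y \<in> carrier G" "ord y = q ^ v"
    using cyc q by (auto simp: cyclic_sylows_def v_def)
  let ?U = "roots G (large_part (Suc q) (order G))" and ?Y = "generate G {y}"
  have pos: "order G > 0" using fin order_gt_0_iff_finite by blast
  have eq: "large_part q (order G) = q ^ v * large_part (Suc q) (order G)"
    unfolding v_def by (rule large_part_step[OF q pos])
  have Y: "subgroup ?Y G" using y(1) by (intro generate_is_subgroup) simp
  have T: "subgroup (?U <#> ?Y) G"
    using mult_norm_subgroup[OF normal_roots[OF U] Y] .
  have cU: "card ?U = large_part (Suc q) (order G)"
    using card_roots_large_part[OF fin cyc] .
  have cY: "card ?Y = q ^ v" using generate_pow_card[OF y(1)] y(2) by simp
  have "\<not> q dvd large_part (Suc q) (order G)"
    using prime_dvd_large_part[OF q, of "Suc q"] by auto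
  then have "coprime q (large_part (Suc q) (order G))" using prime_imp_coprime[OF q] by blast
  then have "coprime (card ?U) (card ?Y)"
    unfolding cU cY using coprime_commute coprime_power_right_iff by blast
  then have cT: "card (?U <#> ?Y) = large_part q (order G)"
    using card_set_mult_coprime[OF U Y] by (simp add: cU cY eq)
  have sub: "?U <#> ?Y \<subseteq> roots G (large_part q (order G))"
  proof
    fix x assume "x \<in> ?U <#> ?Y"
    then show "x \<in> roots G (large_part q (order G))"
      using pow_card_subgroup[OF T] subgroup.mem_carrier[OF T] cT by (simp add: roots_def)
  qed
  have "?U <#> ?Y = roots G (large_part q (order G))"
  proof (rule card_subset_eq[OF _ sub])
    show "finite (roots G (large_part q (order G)))" using fin by (simp add: roots_def)
    show "card (?U <#> ?Y) = card (roots G (large_part q (order G)))"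
      using cT card_roots_large_part[OF fin cyc] by simp
  qed
  then show ?thesis using y T by auto
qed

lemma subgroup_roots_large_part:
  assumes fin: "finite (carrier G)" and cyc: "cyclic_sylows G"
  shows "subgroup (roots G (large_part q (order G))) G"
proof -
  have pos: "order G > 0" using fin order_gt_0_iff_finite by blast
  have one: "roots G 1 = {\<one>}" by (auto simp: roots_def)
  have top: "subgroup (roots G (large_part q (order G))) G" if "order G < q" for q
    using large_part_top[OF pos that] one triv_subgroup by simp
  show ?thesis
  proof (cases "q \<le> Suc (order G)")
    case False
    then show ?thesis using top by simp
  next
    case True
    then show ?thesis
    proof (induction rule: inc_induct)
      case base
      show ?case by (rule top) simp
    next
      case (step q)
      show ?case
      proof (cases "Factorial_Ring.prime q")
        case True
        then show ?thesis using roots_large_part_step[OF fin cyc True step.IH] by blast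
      next
        case False
        then show ?thesis using step.IH by (simp add: large_part_step_nonprime)
      qed
    qed
  qed
qed

text \<open>
  In the normal series below, \<open>Q\<close> is a prime power. Then the divisibility assumption holds up to
  exchanging \<open>i\<close> and \<open>j\<close>, and it says which of the two elements is, modulo \<open>U\<close>, a power of the
  other. Here \<open>w y\<^sup>j\<close> is congruent to the power \<open>(u y\<^sup>i)\<^sup>k\<close>, and the quotient of the two
  lies in \<open>M \<inter> U\<close>, which is central in \<open>M\<close>.\<close>

lemma commute_if_exponent_dvd:
  assumes U: "U \<lhd> G" and M: "subgroup M G" and y: "y \<in> carrier G" "ord y = Q"
    and central: "\<And>d m. d \<in> M \<inter> U \<Longrightarrow> m \<in> M \<Longrightarrow> d \<otimes> m = m \<otimes> d"
    and u: "u \<in> U" "w \<in> U" and x: "u \<otimes> y [^] (i::nat) \<in> M" and z: "w \<otimes> y [^] (j::nat) \<in> M"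
    and dvd: "gcd i Q dvd gcd j Q"
  shows "(w \<otimes> y [^] j) \<otimes> (u \<otimes> y [^] i) = (u \<otimes> y [^] i) \<otimes> (w \<otimes> y [^] j)"
proof -
  interpret U: normal U G by fact
  interpret M: subgroup M G by fact
  let ?x = "u \<otimes> y [^] i" and ?z = "w \<otimes> y [^] j"
  have c: "u \<in> carrier G" "w \<in> carrier G" "?x \<in> carrier G" "?z \<in> carrier G"
    using u U.mem_carrier y by auto
  have "gcd i Q dvd j" using dvd by simp
  then obtain k where k: "[i * k = j] (mod Q)" using cong_solve_dvd_nat by blast
  obtain t where t: "t \<in> U" "?x [^] k = t \<otimes> (y [^] i) [^] k"
    using pow_mult_mem_coset[OF U u(1), of "y [^] i" k] y by auto
  have "(y [^] i) [^] k = y [^] j"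
    using pow_eq_if_cong[OF y(1) _ k] y pow_ord_eq_1 nat_pow_pow by metis
  then have xk: "?x [^] k = t \<otimes> y [^] j" using t by simp
  have tc: "t \<in> carrier G" using t U.mem_carrier by blast
  define d where "d = ?z \<otimes> inv (?x [^] k)"
  have "d = w \<otimes> inv t"
    unfolding d_def xk using tc c y by (simp add: inv_mult_group m_assoc cancel_inv_left)
  then have dU: "d \<in> U" using u t by simp
  have "?x [^] k \<in> M" using nat_pow_mem_subgroup[OF M x] .
  then have dM: "d \<in> M" unfolding d_def using z by simp
  have dc: "d \<in> carrier G" using dM M.mem_carrier by blast
  have zeq: "?z = d \<otimes> ?x [^] k" unfolding d_def using c by (simp add: m_assoc)
  have "d \<otimes> ?x = ?x \<otimes> d" using central[of d ?x] dM dU x by blast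
  moreover have "?x [^] k \<otimes> ?x = ?x \<otimes> ?x [^] k" using group_commutes_pow[of ?x ?x k] c by simp
  ultimately have "(d \<otimes> ?x [^] k) \<otimes> ?x = ?x \<otimes> (d \<otimes> ?x [^] k)"
    using dc c by (metis m_assoc nat_pow_closed)
  then show ?thesis unfolding zeq[symmetric] .
qed

lemma normal_centralizer_of_normal:
  assumes A: "A \<lhd> G"
  shows "{g \<in> carrier G. \<forall>a\<in>A. g \<otimes> a = a \<otimes> g} \<lhd> G" (is "?C \<lhd> G")
proof -
  interpret A: normal A G by fact
  have s: "subgroup ?C G"
  proof (rule subgroupI)
    show "?C \<noteq> {}" using A.subset by auto
    fix g assume g: "g \<in> ?C"
    have cent: "g \<in> centralizer G a \<longleftrightarrow> g \<in> carrier G \<and> g \<otimes> a = a \<otimes> g" for g a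
      by (simp add: centralizer_def)
    have "inv g \<in> centralizer G a" if "a \<in> A" for a
      using g that cent subgroup.m_inv_closed[OF subgroup_centralizer[OF A.mem_carrier[OF that]]] by simp
    then show "inv g \<in> ?C" using g cent by simp
    fix h assume h: "h \<in> ?C"
    have "g \<otimes> h \<in> centralizer G a" if "a \<in> A" for a
      using g h that cent subgroup.m_closed[OF subgroup_centralizer[OF A.mem_carrier[OF that]]] by simp
    then show "g \<otimes> h \<in> ?C" using g h cent by simp
  qed auto
  moreover have "h \<otimes> g \<otimes> inv h \<in> ?C" if h: "h \<in> carrier G" and g: "g \<in> ?C" for h g
  proof -
    have "(h \<otimes> g \<otimes> inv h) \<otimes> a = a \<otimes> (h \<otimes> g \<otimes> inv h)" if a: "a \<in> A" for a
    proof -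
      have ac: "a \<in> carrier G" using a by simp
      define b where "b = inv h \<otimes> a \<otimes> h"
      have b: "b \<in> A" unfolding b_def using A.inv_op_closed1[OF h a] .
      then have gb: "g \<otimes> b = b \<otimes> g" "b \<in> carrier G" using g by auto
      have aeq: "a = h \<otimes> b \<otimes> inv h" unfolding b_def using h ac by (simp add: m_assoc cancel_inv_left)
      have "(h \<otimes> g \<otimes> inv h) \<otimes> a = h \<otimes> (g \<otimes> b) \<otimes> inv h"
        unfolding aeq using h g gb(2) by (simp add: m_assoc cancel_inv_left)
      also have "\<dots> = a \<otimes> (h \<otimes> g \<otimes> inv h)"
        unfolding aeq gb(1) using h g gb(2) by (simp add: m_assoc cancel_inv_left)
      finally show ?thesis .
    qed
    then show ?thesis using h g by auto
  qed
  ultimately show ?thesis by (simp add: normal_inv_iff)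
qed

lemma normal_set_mult:
  assumes A: "A \<lhd> G" and M: "M \<lhd> G"
  shows "A <#> M \<lhd> G"
proof -
  interpret A: normal A G by fact
  interpret M: normal M G by fact
  have "g \<otimes> (a \<otimes> m) \<otimes> inv g \<in> A <#> M" if "g \<in> carrier G" "a \<in> A" "m \<in> M" for g a m
  proof -
    have "g \<otimes> (a \<otimes> m) \<otimes> inv g = (g \<otimes> a \<otimes> inv g) \<otimes> (g \<otimes> m \<otimes> inv g)"
      using that A.mem_carrier M.mem_carrier by (simp add: conj_mult)
    also have "\<dots> \<in> A <#> M"
      using A.inv_op_closed2[OF that(1,2)] M.inv_op_closed2[OF that(1,3)] unfolding set_mult_def by blast
    finally show ?thesis .
  qed
  then show ?thesis using mult_norm_subgroup[OF A M.subgroup_axioms]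
    by (auto simp: normal_inv_iff set_mult_def)
qed

text \<open>
  Let \<open>A\<close> be maximal among the abelian normal subgroups and \<open>C\<close> its centralizer. Going up the
  normal series, suppose that \<open>C\<close> meets one term inside \<open>A\<close>, and let \<open>M\<close> be the intersection of
  \<open>C\<close> with the next term. Then \<open>M\<close> is abelian, being cyclic modulo a central subgroup. Hence \<open>A M\<close>
  is an abelian normal subgroup and \<open>M \<subseteq> A\<close> by maximality. The last term of the series is \<open>G\<close>.\<close>

theorem ex_self_centralizing_normal_abelian:
  assumes fin: "finite (carrier G)" and cyc: "cyclic_sylows G"
  shows "\<exists>A. A \<lhd> G \<and> (\<forall>a\<in>A. \<forall>b\<in>A. a \<otimes> b = b \<otimes> a) \<and>
    (\<forall>g\<in>carrier G. (\<forall>a\<in>A. g \<otimes> a = a \<otimes> g) \<longrightarrow> g \<in> A)"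
proof -
  define F where "F = {A. A \<lhd> G \<and> (\<forall>a\<in>A. \<forall>b\<in>A. a \<otimes> b = b \<otimes> a)}"
  have "F \<subseteq> Pow (carrier G)" unfolding F_def using normal_imp_subgroup subgroup.subset by blast
  then have finF: "finite F" using fin finite_subset by blast
  have oneF: "{\<one>} \<in> F" unfolding F_def using one_is_normal by simp
  obtain A where AF: "A \<in> F" and max: "\<And>B. B \<in> F \<Longrightarrow> A \<subseteq> B \<Longrightarrow> A = B"
    using finite_has_maximal2[OF finF oneF] by metis
  have A: "A \<lhd> G" "\<And>a b. a \<in> A \<Longrightarrow> b \<in> A \<Longrightarrow> a \<otimes> b = b \<otimes> a"
    using AF unfolding F_def by blast+
  interpret A: normal A G by (rule A(1))
  define C where "C = {g \<in> carrier G. \<forall>a\<in>A. g \<otimes> a = a \<otimes> g}"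
  define U where "U q = roots G (large_part q (order G))" for q
  have pos: "order G > 0" using fin order_gt_0_iff_finite by blast
  have C: "C \<lhd> G" unfolding C_def using normal_centralizer_of_normal[OF A(1)] .
  have U: "U q \<lhd> G" for q
    unfolding U_def using normal_roots[OF subgroup_roots_large_part[OF fin cyc]] .
  have sub: "C \<inter> U q \<subseteq> A" if "q \<le> Suc (order G)" for q
    using that
  proof (induction rule: inc_induct)
    case base
    have "U (Suc (order G)) = {\<one>}"
      unfolding U_def large_part_top[OF pos lessI] by (auto simp: roots_def)
    then show ?case by auto
  next
    case (step q)
    show ?case
    proof (cases "Factorial_Ring.prime q")
      case False
      then show ?thesis using step.IH by (simp add: U_def large_part_step_nonprime)
    next
      case True
      obtain y v where y: "y \<in> carrier G" "ord y = q ^ v" "U q = U (Suc q) <#> generate G {y}"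
        using roots_large_part_step[OF fin cyc True subgroup_roots_large_part[OF fin cyc]]
        unfolding U_def by blast
      have repr: "\<exists>u\<in>U (Suc q). \<exists>i::nat. x = u \<otimes> y [^] i" if "x \<in> U q" for x
        using that unfolding y(3) generate_pow_on_finite_carrier[OF fin y(1)]
        by (auto simp: set_mult_def)
      define M where "M = C \<inter> U q"
      have M: "M \<lhd> G" unfolding M_def using normal_subgroup_intersect[OF C U] .
      have "x \<otimes> z = z \<otimes> x" if x: "x \<in> M" and z: "z \<in> M" for x z
      proof -
        obtain u i where u: "u \<in> U (Suc q)" "x = u \<otimes> y [^] (i::nat)" using repr x M_def by blast
        obtain w j where w: "w \<in> U (Suc q)" "z = w \<otimes> y [^] (j::nat)" using repr z M_def by blast
        have central: "d \<otimes> m = m \<otimes> d" if "d \<in> M \<inter> U (Suc q)" "m \<in> M" for d m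
        proof -
          have "d \<in> A" "m \<in> C" using that step.IH M_def by auto
          then show ?thesis by (simp add: C_def)
        qed
        note * = commute_if_exponent_dvd[OF U normal_imp_subgroup[OF M] y(1,2) central]
        show ?thesis
          using primepow_gcd_total[OF True, of i v j] *[OF _ _ u(1) w(1), of i j] *[OF _ _ w(1) u(1), of j i]
            x z u(2) w(2) by auto
      qed
      note Mcomm = this
      have AM: "a \<otimes> m = m \<otimes> a" if "a \<in> A" "m \<in> M" for a m
        using that by (simp add: M_def C_def)
      interpret M: normal M G by fact
      have "A <#> M \<lhd> G" using normal_set_mult[OF A(1) M] .
      moreover have "s \<otimes> t = t \<otimes> s" if st: "s \<in> A <#> M" "t \<in> A <#> M" for s t
      proof -
        obtain a m where s: "s = a \<otimes> m" "a \<in> A" "m \<in> M" using st by (auto simp: set_mult_def)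
        obtain b n where t: "t = b \<otimes> n" "b \<in> A" "n \<in> M" using st by (auto simp: set_mult_def)
        have c: "a \<in> carrier G" "b \<in> carrier G" "m \<in> carrier G" "n \<in> carrier G"
          using s t A.mem_carrier M.mem_carrier by auto
        have "s \<otimes> t = a \<otimes> (m \<otimes> b) \<otimes> n" using s t c by (simp add: m_assoc)
        also have "m \<otimes> b = b \<otimes> m" using AM[OF t(2) s(3)] by simp
        also have "a \<otimes> (b \<otimes> m) \<otimes> n = (a \<otimes> b) \<otimes> (m \<otimes> n)" using c by (simp add: m_assoc)
        also have "a \<otimes> b = b \<otimes> a" using A(2)[OF s(2) t(2)] .
        also have "m \<otimes> n = n \<otimes> m" using Mcomm[OF s(3) t(3)] .
        also have "(b \<otimes> a) \<otimes> (n \<otimes> m) = b \<otimes> (a \<otimes> n) \<otimes> m" using c by (simp add: m_assoc)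
        also have "a \<otimes> n = n \<otimes> a" using AM[OF s(2) t(3)] .
        also have "b \<otimes> (n \<otimes> a) \<otimes> m = t \<otimes> s" using s t c by (simp add: m_assoc)
        finally show ?thesis .
      qed
      ultimately have "A <#> M \<in> F" unfolding F_def by blast
      moreover have "A \<subseteq> A <#> M"
      proof
        fix a assume "a \<in> A"
        then have "a \<otimes> \<one> \<in> A <#> M" using M.one_closed unfolding set_mult_def by blast
        then show "a \<in> A <#> M" using \<open>a \<in> A\<close> by simp
      qed
      ultimately have "A = A <#> M" by (rule max)
      moreover have "M \<subseteq> A <#> M"
      proof
        fix m assume "m \<in> M"
        then have "\<one> \<otimes> m \<in> A <#> M" using A.one_closed unfolding set_mult_def by blast
        then show "m \<in> A <#> M" using \<open>m \<in> M\<close> by simp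
      qed
      ultimately show ?thesis unfolding M_def by blast
    qed
  qed
  have "U 0 = carrier G" unfolding U_def using large_part_0[OF pos] roots_order by simp
  then have "C \<subseteq> A" using sub[of 0] C_def by auto
  then show ?thesis using A(1) AF unfolding C_def F_def by blast
qed

end


section \<open>Normal subgroups and quotients\<close>

context group
begin

lemma ord_mult_coprime:
  assumes xy: "x \<in> carrier G" "y \<in> carrier G" "x \<otimes> y = y \<otimes> x" and cop: "coprime (ord x) (ord y)"
  shows "ord (x \<otimes> y) = ord x * ord y"
proof -
  let ?n = "ord (x \<otimes> y)"
  have *: "ord u dvd ord (u \<otimes> w)" if u: "u \<in> carrier G" "w \<in> carrier G" "u \<otimes> w = w \<otimes> u"
    "coprime (ord u) (ord w)" for u w
  proof -
    let ?k = "ord (u \<otimes> w) * ord w"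
    have "\<one> = (u \<otimes> w) [^] ?k" using u pow_eq_id[of "u \<otimes> w" ?k] by simp
    also have "\<dots> = u [^] ?k \<otimes> w [^] ?k" using pow_mult_distrib[OF u(3,1,2)] .
    also have "w [^] ?k = \<one>" using u pow_eq_id[of w ?k] by simp
    finally have "ord u dvd ?k" using u pow_eq_id[of u ?k] by simp
    then show ?thesis using u(4) coprime_dvd_mult_left_iff by blast
  qed
  have "ord x dvd ?n" using *[OF xy cop] .
  moreover have "ord y dvd ?n"
    using *[OF xy(2,1) xy(3)[symmetric]] cop xy(3) by (simp add: coprime_commute)
  ultimately have "ord x * ord y dvd ?n" using cop by (simp add: divides_mult)
  then show ?thesis using ord_mul_divides[OF xy(3,1,2)] by (rule dvd_antisym[rotated])
qed

lemma pow_eq_iff_cong: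
  fixes m n :: nat
  assumes "x \<in> carrier G"
  shows "x [^] m = x [^] n \<longleftrightarrow> [m = n] (mod (ord x))"
proof -
  have "x [^] m = x [^] n \<longleftrightarrow> int (ord x) dvd int n - int m"
    using int_pow_eq[OF assms, of "int m" "int n"] by (simp add: int_pow_int)
  also have "\<dots> \<longleftrightarrow> [n = m] (mod (ord x))"
    by (simp add: cong_iff_dvd_diff flip: cong_int_iff)
  finally show ?thesis by (simp add: cong_sym_eq)
qed

lemma ord_subgroup:
  assumes "subgroup H G"
  shows "group.ord (G\<lparr>carrier := H\<rparr>) x = ord x"
  using assms by (simp add: group.ord_def[OF subgroup_imp_group] ord_def flip: nat_pow_consistent)

lemma pow_index_mem:
  assumes N: "N \<lhd> G" and x: "x \<in> carrier G"
  shows "x [^] card (rcosets N) \<in> N"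
proof -
  interpret N: normal N G by fact
  interpret Q: group "G Mod N" by (rule N.factorgroup_is_group)
  have "N #> x \<in> carrier (G Mod N)" using x by (simp add: carrier_FactGroup)
  then have "(N #> x) [^]\<^bsub>G Mod N\<^esub> order (G Mod N) = N"
    using Q.pow_order_eq_1 by simp
  moreover have "order (G Mod N) = card (rcosets N)" by (simp add: order_def FactGroup_def)
  ultimately have "N #> (x [^] card (rcosets N)) = N"
    using x by (simp add: N.FactGroup_pow)
  then show ?thesis using coset_join1[OF _ _ N.subgroup_axioms] N.subset x by blast
qed

text \<open>
  If \<open>y\<close> generates a Sylow \<open>p\<close>-subgroup of \<open>G\<close>, then this power, which lies in \<open>N\<close>, generates
  one of \<open>N\<close>: raising to the index removes exactly the \<open>p\<close>-part of the index from the order.\<close>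

lemma ord_pow_index_eq:
  assumes fin: "finite (carrier G)" and N: "N \<lhd> G" and p: "Factorial_Ring.prime p"
    and y: "y \<in> carrier G" "ord y = p ^ multiplicity p (order G)"
  shows "ord (y [^] card (rcosets N)) = p ^ multiplicity p (card N)"
proof -
  define k where "k = card (rcosets N)"
  have sN: "subgroup N G" using N normal_imp_subgroup by blast
  have ordG: "k * card N = order G" unfolding k_def by (rule lagrange[OF sN])
  have "order G > 0" using fin order_gt_0_iff_finite by blast
  then have k0: "k \<noteq> 0" and N0: "card N \<noteq> 0" using ordG by (auto intro!: Nat.gr0I)
  have v: "multiplicity p (order G) = multiplicity p k + multiplicity p (card N)"
    unfolding ordG[symmetric] using prime_imp_prime_elem[OF p] k0 N0 by (intro prime_elem_multiplicity_mult_distrib) auto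
  define e where "e = multiplicity p k"
  define f where "f = multiplicity p (card N)"
  have npu: "\<not> is_unit p" using p not_prime_unit by blast
  obtain r where r: "k = p ^ e * r" "\<not> p dvd r"
    using multiplicity_decompose'[OF k0 npu] unfolding e_def by blast
  have "coprime (p ^ f) r" using prime_imp_coprime[OF p r(2)] by simp
  then have "gcd (p ^ (e + f)) k = p ^ e"
    unfolding r(1) power_add by (simp add: gcd_mult_left)
  then have "ord (y [^] k) = p ^ (e + f) div p ^ e"
    using ord_pow_gen[OF y(1), of k] k0 y(2) v by (simp add: e_def f_def)
  also have "\<dots> = p ^ f" using p prime_gt_0_nat by (simp add: power_add)
  finally show ?thesis unfolding k_def f_def .
qed

lemma cyclic_sylows_normal:
  assumes fin: "finite (carrier G)" and cyc: "cyclic_sylows G" and N: "N \<lhd> G"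
  shows "cyclic_sylows (G\<lparr>carrier := N\<rparr>)"
  unfolding cyclic_sylows_def
proof (intro allI impI)
  fix p :: nat assume p: "Factorial_Ring.prime p"
  obtain y where y: "y \<in> carrier G" "ord y = p ^ multiplicity p (order G)"
    using cyc p by (auto simp: cyclic_sylows_def)
  have "ord (y [^] card (rcosets N)) = p ^ multiplicity p (card N)"
    by (rule ord_pow_index_eq[OF fin N p y])
  then show "\<exists>y\<in>carrier (G\<lparr>carrier := N\<rparr>). group.ord (G\<lparr>carrier := N\<rparr>) y
      = p ^ multiplicity p (order (G\<lparr>carrier := N\<rparr>))"
    using pow_index_mem[OF N y(1)] ord_subgroup[OF normal_imp_subgroup[OF N]]
    by (auto simp: order_def)
qed

text \<open>
  The order of \<open>N y\<close> is a power \<open>p\<^sup>i\<close> that divides \<open>|G / N|\<close>, which bounds \<open>i\<close> from above. On the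
  other hand \<open>y\<close> to the power \<open>p\<^sup>i\<close> lies in \<open>N\<close>, so its order divides \<open>|N|\<close>, which bounds \<open>i\<close> from below.\<close>

lemma cyclic_sylows_quotient:
  assumes fin: "finite (carrier G)" and cyc: "cyclic_sylows G" and N: "N \<lhd> G"
  shows "cyclic_sylows (G Mod N)"
  unfolding cyclic_sylows_def
proof (intro allI impI)
  fix p :: nat assume p: "Factorial_Ring.prime p"
  interpret N: normal N G by fact
  interpret Q: group "G Mod N" by (rule N.factorgroup_is_group)
  define k where "k = card (rcosets N)"
  have ordQ: "order (G Mod N) = k" by (simp add: order_def FactGroup_def k_def)
  have ordG: "k * card N = order G" unfolding k_def by (rule lagrange[OF N.subgroup_axioms])
  have "order G > 0" using fin order_gt_0_iff_finite by blast
  then have k0: "k \<noteq> 0" and N0: "card N \<noteq> 0" using ordG by (auto intro!: Nat.gr0I)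
  define e where "e = multiplicity p k"
  define f where "f = multiplicity p (card N)"
  have v: "multiplicity p (order G) = e + f"
    unfolding ordG[symmetric] e_def f_def using prime_imp_prime_elem[OF p] k0 N0
    by (intro prime_elem_multiplicity_mult_distrib) auto
  obtain y where y: "y \<in> carrier G" "ord y = p ^ (e + f)"
    using cyc p v by (auto simp: cyclic_sylows_def)
  have yQ: "N #> y \<in> carrier (G Mod N)" using y by (simp add: carrier_FactGroup)
  have npu: "\<not> is_unit p" using p not_prime_unit by blast
  have p0: "p > 0" using p prime_gt_0_nat by blast
  have "(N #> y) [^]\<^bsub>G Mod N\<^esub> (p ^ (e + f)) = \<one>\<^bsub>G Mod N\<^esub>"
    using y pow_ord_eq_1[OF y(1)] N.subset by (simp add: N.FactGroup_pow)
  then have "Q.ord (N #> y) dvd p ^ (e + f)" using Q.pow_eq_id[OF yQ] by blast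
  then obtain i where i: "Q.ord (N #> y) = p ^ i" "i \<le> e + f"
    using divides_primepow_nat[OF p] by blast
  have "p ^ i dvd k" using Q.ord_dvd_group_order[OF yQ] i ordQ by simp
  then have "i \<le> e" unfolding e_def using k0 npu by (intro multiplicity_geI) auto
  have "N #> (y [^] (p ^ i)) = N"
    using Q.pow_ord_eq_1[OF yQ] y(1) i by (simp add: N.FactGroup_pow)
  then have "y [^] (p ^ i) \<in> N"
    using coset_join1[OF _ _ N.subgroup_axioms] N.subset y(1) by blast
  then have "ord (y [^] (p ^ i)) dvd card N" by (rule ord_dvd_card_subgroup[OF N.subgroup_axioms])
  moreover have "ord (y [^] (p ^ i)) = p ^ (e + f - i)"
    using ord_pow[OF y(1), of "p ^ i"] y(2) i(2) p0
    by (simp add: le_imp_power_dvd power_diff)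
  ultimately have "e + f - i \<le> f" unfolding f_def using N0 npu by (intro multiplicity_geI) auto
  then have "i = e" using \<open>i \<le> e\<close> i(2) by simp
  then show "\<exists>y\<in>carrier (G Mod N). group.ord (G Mod N) y = p ^ multiplicity p (order (G Mod N))"
    using yQ i(1) ordQ e_def by auto
qed

text \<open>Moving all factors \<open>y\<close> to the left past powers of \<open>x\<close> replaces \<open>x\<close> by \<open>x\<close> to the power \<open>s\<^sup>i\<close>.\<close>

lemma twisted_pow:
  assumes y: "y \<in> carrier G" and x: "x \<in> carrier G" and s: "inv y \<otimes> x \<otimes> y = x [^] (s::nat)"
  shows "(y \<otimes> x) [^] (n::nat) = y [^] n \<otimes> x [^] (\<Sum>i<n. s ^ i)"
proof (induction n)
  case 0
  then show ?case by simp
next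
  case (Suc n)
  let ?E = "\<Sum>i<n. s ^ i"
  have "inv y \<otimes> x [^] ?E \<otimes> y = (x [^] s) [^] ?E"
    using conj_nat_pow[of "inv y" x ?E] y x s by simp
  then have tw: "x [^] ?E \<otimes> y = y \<otimes> x [^] (s * ?E)"
    using y x by (metis cancel_inv_left(2) inv_closed m_assoc m_closed nat_pow_closed nat_pow_pow)
  have "(y \<otimes> x) [^] Suc n = y [^] n \<otimes> (x [^] ?E \<otimes> y) \<otimes> x"
    using Suc.IH y x by (simp add: m_assoc)
  also have "\<dots> = y [^] Suc n \<otimes> (x [^] (s * ?E) \<otimes> x)"
    unfolding tw using y x by (simp add: m_assoc)
  also have "x [^] (s * ?E) \<otimes> x = x [^] (\<Sum>i<Suc n. s ^ i)"
  proof -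
    have "(\<Sum>i<Suc n. s ^ i) = Suc (s * ?E)"
      by (simp add: sum.lessThan_Suc_shift sum_distrib_left del: sum.lessThan_Suc)
    then show ?thesis by (simp del: sum.lessThan_Suc)
  qed
  finally show ?case .
qed

end

text \<open>The product of generators of the Sylow subgroups has the product of their orders as its order.\<close>

lemma (in comm_group) cyclic_if_cyclic_sylows:
  assumes fin: "finite (carrier G)" and cyc: "cyclic_sylows G"
  shows "\<exists>a\<in>carrier G. ord a = order G"
proof -
  have ex: "\<exists>a\<in>carrier G. ord a = (\<Prod>p\<in>S. p ^ multiplicity p (order G))"
    if "finite S" "\<And>p. p \<in> S \<Longrightarrow> Factorial_Ring.prime p" for S
    using that
  proof (induction S rule: finite_induct)
    case empty
    then show ?case by (auto intro: bexI[of _ \<one>])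
  next
    case (insert p S)
    have p: "Factorial_Ring.prime p" using insert.prems by simp
    obtain a where a: "a \<in> carrier G" "ord a = (\<Prod>p\<in>S. p ^ multiplicity p (order G))"
      using insert.IH insert.prems by auto
    obtain y where y: "y \<in> carrier G" "ord y = p ^ multiplicity p (order G)"
      using cyc p by (auto simp: cyclic_sylows_def)
    have "coprime (ord y) (ord a)"
      unfolding y(2) a(2)
    proof (rule prod_coprime_right)
      fix q assume q: "q \<in> S"
      then have "Factorial_Ring.prime q" "p \<noteq> q" using insert by auto
      then show "coprime (p ^ multiplicity p (order G)) (q ^ multiplicity q (order G))"
        using primes_coprime[OF p] by simp
    qed
    then have "ord (y \<otimes> a) = (\<Prod>p\<in>insert p S. p ^ multiplicity p (order G))"
      using ord_mult_coprime[OF y(1) a(1) m_comm[OF y(1) a(1)]] insert.hyps y(2) a(2) by simp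
    then show ?case using y(1) a(1) by blast
  qed
  have "order G > 0" using fin order_gt_0_iff_finite by blast
  moreover have "\<exists>a\<in>carrier G. ord a = (\<Prod>p\<in>prime_factors (order G). p ^ multiplicity p (order G))"
    by (rule ex) (auto simp: in_prime_factors_iff)
  ultimately show ?thesis by (simp flip: prime_factorization_nat)
qed


section \<open>The factorization into cyclic subgroups of coprime orders\<close>

context group
begin

lemma normal_cyclic_conj_pow:
  assumes fin: "finite (carrier G)" and A: "generate G {a} \<lhd> G" and a: "a \<in> carrier G"
    and g: "g \<in> carrier G"
  shows "\<exists>s::nat. \<forall>x\<in>generate G {a}. inv g \<otimes> x \<otimes> g = x [^] s"
proof -
  interpret A: normal "generate G {a}" G by fact
  have gen: "generate G {a} = {a [^] k | k. k \<in> (UNIV :: nat set)}"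
    using generate_pow_on_finite_carrier[OF fin a] .
  have "a \<in> generate G {a}" by (rule generate.incl) simp
  then have "inv g \<otimes> a \<otimes> g \<in> generate G {a}" using A.inv_op_closed1[OF g] by blast
  then obtain s :: nat where s: "inv g \<otimes> a \<otimes> g = a [^] s" unfolding gen by blast
  have "inv g \<otimes> a [^] k \<otimes> g = (a [^] k) [^] s" for k :: nat
  proof -
    have "inv g \<otimes> a [^] k \<otimes> g = (a [^] s) [^] k"
      using conj_nat_pow[of "inv g" a k] g a s by simp
    then show ?thesis using a by (simp add: nat_pow_pow mult.commute)
  qed
  then show ?thesis unfolding gen by blast
qed

text \<open>
  \<open>g\<close> and \<open>h\<close> act on \<open>\<langle>a\<rangle>\<close> by raising to powers, and these actions commute. The commutator
  therefore centralizes \<open>a\<close>.\<close>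

lemma commutator_mem_self_centralizing_cyclic:
  assumes fin: "finite (carrier G)" and A: "generate G {a} \<lhd> G" and a: "a \<in> carrier G"
    and self: "\<And>g. g \<in> carrier G \<Longrightarrow> g \<otimes> a = a \<otimes> g \<Longrightarrow> g \<in> generate G {a}"
    and gh: "g \<in> carrier G" "h \<in> carrier G"
  shows "(g \<otimes> h) \<otimes> inv (h \<otimes> g) \<in> generate G {a}"
proof (rule self)
  let ?A = "generate G {a}"
  have aA: "a \<in> ?A" by (rule generate.incl) simp
  obtain s :: nat where s: "\<And>x. x \<in> ?A \<Longrightarrow> inv g \<otimes> x \<otimes> g = x [^] s"
    using normal_cyclic_conj_pow[OF fin A a gh(1)] by blast
  obtain r :: nat where r: "\<And>x. x \<in> ?A \<Longrightarrow> inv h \<otimes> x \<otimes> h = x [^] r"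
    using normal_cyclic_conj_pow[OF fin A a gh(2)] by blast
  have pow: "a [^] k \<in> ?A" for k :: nat
    using nat_pow_mem_subgroup[OF normal_imp_subgroup[OF A] aA] .
  have "inv (g \<otimes> h) \<otimes> a \<otimes> (g \<otimes> h) = inv h \<otimes> (inv g \<otimes> a \<otimes> g) \<otimes> h"
    using gh a by (simp add: inv_mult_group m_assoc)
  also have "\<dots> = (a [^] s) [^] r" using s[OF aA] r[OF pow] by simp
  finally have 1: "inv (g \<otimes> h) \<otimes> a \<otimes> (g \<otimes> h) = a [^] (s * r)" using a by (simp add: nat_pow_pow)
  have "inv (h \<otimes> g) \<otimes> a \<otimes> (h \<otimes> g) = inv g \<otimes> (inv h \<otimes> a \<otimes> h) \<otimes> g"
    using gh a by (simp add: inv_mult_group m_assoc)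
  also have "\<dots> = (a [^] r) [^] s" using r[OF aA] s[OF pow] by simp
  finally have 2: "inv (h \<otimes> g) \<otimes> a \<otimes> (h \<otimes> g) = a [^] (s * r)"
    using a by (simp add: nat_pow_pow mult.commute)
  define u where "u = g \<otimes> h"
  define w where "w = h \<otimes> g"
  have uw: "u \<in> carrier G" "w \<in> carrier G" using gh by (simp_all add: u_def w_def)
  have au: "a \<otimes> u = u \<otimes> a [^] (s * r)"
    using 1 uw a unfolding u_def[symmetric] by (metis cancel_inv_left(2) inv_closed m_assoc m_closed)
  have aw: "a \<otimes> w = w \<otimes> a [^] (s * r)"
    using 2 uw a unfolding w_def[symmetric] by (metis cancel_inv_left(2) inv_closed m_assoc m_closed)
  have wa: "inv w \<otimes> a = a [^] (s * r) \<otimes> inv w"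
  proof -
    have "inv w \<otimes> a = inv w \<otimes> (a \<otimes> w) \<otimes> inv w" using uw a by (simp add: m_assoc)
    also have "\<dots> = a [^] (s * r) \<otimes> inv w" unfolding aw using uw a by (simp add: cancel_inv_left)
    finally show ?thesis .
  qed
  show "(g \<otimes> h) \<otimes> inv (h \<otimes> g) \<in> carrier G" using gh by simp
  have "(u \<otimes> inv w) \<otimes> a = u \<otimes> a [^] (s * r) \<otimes> inv w" using uw a wa by (simp add: m_assoc)
  also have "\<dots> = a \<otimes> (u \<otimes> inv w)" unfolding au[symmetric] using uw a by (simp add: m_assoc)
  finally show "(g \<otimes> h) \<otimes> inv (h \<otimes> g) \<otimes> a = a \<otimes> ((g \<otimes> h) \<otimes> inv (h \<otimes> g))"
    unfolding u_def w_def .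
qed

lemma comm_group_quotient:
  assumes A: "A \<lhd> G"
    and comm: "\<And>g h. g \<in> carrier G \<Longrightarrow> h \<in> carrier G \<Longrightarrow> (g \<otimes> h) \<otimes> inv (h \<otimes> g) \<in> A"
  shows "comm_group (G Mod A)"
proof -
  interpret A: normal A G by fact
  interpret Q: group "G Mod A" by (rule A.factorgroup_is_group)
  show ?thesis
  proof (rule Q.group_comm_groupI)
    fix X Y assume "X \<in> carrier (G Mod A)" "Y \<in> carrier (G Mod A)"
    then obtain g h where g: "g \<in> carrier G" "X = A #> g" and h: "h \<in> carrier G" "Y = A #> h"
      by (auto simp: carrier_FactGroup)
    have "A #> (g \<otimes> h) = A #> ((g \<otimes> h) \<otimes> inv (h \<otimes> g) \<otimes> (h \<otimes> g))"
      using g h by (simp add: m_assoc)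
    also have "\<dots> = A #> (h \<otimes> g)"
      using comm[OF g(1) h(1)] g h
        coset_mult_assoc[OF A.subset, of "(g \<otimes> h) \<otimes> inv (h \<otimes> g)" "h \<otimes> g"]
        coset_join2[OF _ A.subgroup_axioms comm[OF g(1) h(1)]] by simp
    finally show "X \<otimes>\<^bsub>G Mod A\<^esub> Y = Y \<otimes>\<^bsub>G Mod A\<^esub> X"
      using g h by (simp add: A.rcos_sum)
  qed
qed

text \<open>
  Suppose that \<open>p\<close> divides both \<open>|A|\<close> and \<open>m = |G / A|\<close>, and let \<open>y\<close> generate a Sylow
  \<open>p\<close>-subgroup. A power \<open>z\<close> of \<open>y\<close> has order \<open>p\<close> and lies in \<open>A\<close>; it is shown to be central.
  As \<open>G / A\<close> is abelian, a conjugate of \<open>y\<close> has the form \<open>y d\<close> with \<open>d \<in> A\<close>, and \<open>y\<close> acts on \<open>A\<close> as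
  \<open>x \<mapsto> x\<^sup>s\<close>. It fixes the Sylow \<open>p\<close>-subgroup \<open>\<langle>c\<rangle>\<close> of \<open>A\<close>, because \<open>c\<close> is a power of \<open>y\<close>, so \<open>s\<close> is
  congruent to 1 modulo the \<open>p\<close>-part of \<open>|A|\<close>. Raising \<open>y d\<close> to the exponent \<open>n\<close> with
  \<open>y\<^sup>n = z\<close> gives \<open>z w\<close>, where \<open>w\<close> is \<open>d\<close> to the power \<open>\<Sum>i<n. s\<^sup>i\<close>. This exponent is
  congruent to \<open>n\<close>, hence to 0, modulo the \<open>p\<close>-part of \<open>|A|\<close>; so the order of \<open>w\<close> is coprime to
  \<open>p\<close>. It also divides \<open>p\<close>, since \<open>z\<close> and its conjugate \<open>z w\<close> are commuting elements of order \<open>p\<close>.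
  Thus \<open>w = 1\<close>.\<close>

lemma coprime_card_index_self_centralizing:
  assumes fin: "finite (carrier G)" and cyc: "cyclic_sylows G" and center: "center G = {\<one>}"
    and A: "generate G {a} \<lhd> G" and a: "a \<in> carrier G"
    and self: "\<And>g. g \<in> carrier G \<Longrightarrow> g \<otimes> a = a \<otimes> g \<Longrightarrow> g \<in> generate G {a}"
  shows "coprime (card (generate G {a})) (card (rcosets (generate G {a})))"
proof (rule ccontr)
  define A' where "A' = generate G {a}"
  define m where "m = card (rcosets A')"
  interpret A: normal A' G unfolding A'_def by (rule A)
  assume "\<not> coprime (card (generate G {a})) (card (rcosets (generate G {a})))"
  then have "gcd (card A') m \<noteq> 1" unfolding A'_def m_def using coprime_iff_gcd_eq_1 by blast
  then obtain p where p: "Factorial_Ring.prime p" "p dvd gcd (card A') m"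
    using prime_factor_nat by blast
  then have pA: "p dvd card A'" and pm: "p dvd m" by auto
  have npu: "\<not> is_unit p" using p(1) not_prime_unit by blast
  have gen: "A' = {a [^] k | k. k \<in> (UNIV :: nat set)}"
    unfolding A'_def using generate_pow_on_finite_carrier[OF fin a] .
  have A_comm: "x \<otimes> y = y \<otimes> x" if "x \<in> A'" "y \<in> A'" for x y
    using that a unfolding gen by (auto simp: nat_pow_mult add.commute)
  have oa: "ord a = card A'" unfolding A'_def by (rule generate_pow_card[OF a])
  have N0: "card A' \<noteq> 0" using oa ord_ge_1[OF fin a] by simp
  define \<alpha> where "\<alpha> = multiplicity p (card A')"
  have \<alpha>: "\<alpha> \<ge> 1" unfolding \<alpha>_def using pA N0 npu by (intro multiplicity_geI) auto
  obtain t where t: "card A' = p ^ \<alpha> * t" "\<not> p dvd t"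
    using multiplicity_decompose'[OF N0 npu] unfolding \<alpha>_def by blast
  obtain y where y: "y \<in> carrier G" "ord y = p ^ multiplicity p (order G)"
    using cyc p by (auto simp: cyclic_sylows_def)
  define c where "c = y [^] m"
  have cA: "c \<in> A'" unfolding c_def m_def by (rule pow_index_mem[OF A.normal_axioms y(1)])
  have oc: "ord c = p ^ \<alpha>"
    unfolding c_def m_def \<alpha>_def by (rule ord_pow_index_eq[OF fin A.normal_axioms p(1) y])
  define n where "n = m * p ^ (\<alpha> - 1)"
  define z where "z = y [^] n"
  have zc: "z = c [^] (p ^ (\<alpha> - 1))" unfolding z_def c_def n_def using y by (simp add: nat_pow_pow)
  have zA: "z \<in> A'" unfolding zc by (rule nat_pow_mem_subgroup[OF A.subgroup_axioms cA])
  have p0: "p > 0" using p prime_gt_0_nat by blast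
  have oz: "ord z = p"
  proof -
    have "ord z = p ^ \<alpha> div p ^ (\<alpha> - 1)"
      unfolding zc using ord_pow[of c "p ^ (\<alpha> - 1)"] cA oc p0 by (simp add: le_imp_power_dvd)
    also have "\<dots> = p" using \<alpha> p0 by (cases \<alpha>) simp_all
    finally show ?thesis .
  qed
  have cc: "c \<in> carrier G" and zcar: "z \<in> carrier G" using cA zA A.mem_carrier by auto
  have "p ^ \<alpha> dvd n"
  proof -
    have "p * p ^ (\<alpha> - 1) dvd m * p ^ (\<alpha> - 1)" using pm by (intro mult_dvd_mono) auto
    then show ?thesis unfolding n_def using \<alpha> by (cases \<alpha>) simp_all
  qed
  obtain s :: nat where s: "\<And>x. x \<in> A' \<Longrightarrow> inv y \<otimes> x \<otimes> y = x [^] s"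
    using normal_cyclic_conj_pow[OF fin A a y(1)] unfolding A'_def by blast
  have "c [^] s = c [^] (1::nat)"
  proof -
    have "inv y \<otimes> c \<otimes> y = c"
      unfolding c_def using y(1) group_commutes_pow[of y y m] by (simp add: m_assoc cancel_inv_left)
    then show ?thesis using s[OF cA] cc by simp
  qed
  then have s1: "[s = 1] (mod p ^ \<alpha>)" using pow_eq_iff_cong[OF cc, of s 1] oc by simp
  have E: "p ^ \<alpha> dvd (\<Sum>i<n. s ^ i)"
  proof -
    have "[(\<Sum>i<n. s ^ i) = (\<Sum>i<n. 1 ^ i)] (mod p ^ \<alpha>)"
      using s1 by (intro cong_sum cong_pow)
    then have "[(\<Sum>i<n. s ^ i) = n] (mod p ^ \<alpha>)" by simp
    then show ?thesis using \<open>p ^ \<alpha> dvd n\<close> cong_dvd_iff by blast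
  qed
  have "g \<otimes> z = z \<otimes> g" if g: "g \<in> carrier G" for g
  proof -
    define yg where "yg = inv g \<otimes> y \<otimes> g"
    have ygc: "yg \<in> carrier G" using g y by (simp add: yg_def)
    define d where "d = inv y \<otimes> yg"
    have dc: "d \<in> carrier G" using ygc y by (simp add: d_def)
    have yd: "yg = y \<otimes> d" unfolding d_def using ygc y by (simp add: cancel_inv_left)
    have "(inv y \<otimes> inv g) \<otimes> inv (inv g \<otimes> inv y) \<in> A'"
      unfolding A'_def using commutator_mem_self_centralizing_cyclic[OF fin A a self] g y by simp
    then have "(inv y \<otimes> inv g) \<otimes> (y \<otimes> g) \<in> A'" using g y by (simp add: inv_mult_group)
    then have dA: "d \<in> A'" unfolding d_def yg_def using g y by (simp add: m_assoc)
    define w where "w = d [^] (\<Sum>i<n. s ^ i)"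
    have wc: "w \<in> carrier G" using dc by (simp add: w_def)
    have wA: "w \<in> A'" unfolding w_def by (rule nat_pow_mem_subgroup[OF A.subgroup_axioms dA])
    have conjz: "inv g \<otimes> z \<otimes> g = z \<otimes> w"
    proof -
      have "inv g \<otimes> z \<otimes> g = yg [^] n"
        unfolding z_def yg_def using conj_nat_pow[of "inv g" y n] g y by simp
      also have "\<dots> = z \<otimes> w"
        unfolding yd z_def w_def by (rule twisted_pow[OF y(1) dc s[OF dA]])
      finally show ?thesis .
    qed
    have "ord w dvd t"
    proof -
      have "ord d dvd card A'" using ord_dvd_card_subgroup[OF A.subgroup_axioms dA] .
      also have "card A' dvd (\<Sum>i<n. s ^ i) * t" unfolding t(1) using E by (intro mult_dvd_mono) auto
      finally have "d [^] ((\<Sum>i<n. s ^ i) * t) = \<one>" using pow_eq_id[OF dc] by blast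
      then have "w [^] t = \<one>" unfolding w_def using dc by (simp add: nat_pow_pow)
      then show ?thesis using pow_eq_id[OF wc] by blast
    qed
    moreover have "ord w dvd p"
    proof -
      have "(inv g \<otimes> z \<otimes> g) [^] p = \<one>"
        using conj_nat_pow[of "inv g" z p] g zcar oz pow_ord_eq_1[OF zcar] by simp
      then have "z [^] p \<otimes> w [^] p = \<one>"
        unfolding conjz using pow_mult_distrib[OF A_comm[OF zA wA] zcar wc] by simp
      then have "w [^] p = \<one>" using oz pow_ord_eq_1[OF zcar] wc by simp
      then show ?thesis using pow_eq_id[OF wc] by blast
    qed
    ultimately have "ord w dvd gcd p t" by simp
    then have "ord w = 1" using prime_imp_coprime[OF p(1) t(2)] by simp
    then have "w = \<one>" using ord_eq_1[OF wc] by simp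
    then have "inv g \<otimes> z \<otimes> g = z" using conjz zcar by simp
    then have "g \<otimes> (inv g \<otimes> z \<otimes> g) = g \<otimes> z" by simp
    then show ?thesis using g zcar by (simp add: m_assoc cancel_inv_left)
  qed
  then have "z \<in> center G" using zcar by (simp add: center_def)
  then have "ord z = 1" using center by simp
  then show False using oz p(1) by simp
qed

theorem ex_cyclic_hall_factorization:
  assumes fin: "finite (carrier G)" and cyc: "cyclic_sylows G" and center: "center G = {\<one>}"
  shows "\<exists>a\<in>carrier G. \<exists>b\<in>carrier G. generate G {a} \<lhd> G \<and> coprime (ord a) (ord b) \<and>
    carrier G = generate G {a} <#> generate G {b} \<and>
    (\<forall>g\<in>carrier G. g \<otimes> a = a \<otimes> g \<longrightarrow> g \<in> generate G {a}) \<and>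
    card (rcosets (generate G {a})) = ord b"
proof -
  obtain A where A: "A \<lhd> G" and comm: "\<And>x y. x \<in> A \<Longrightarrow> y \<in> A \<Longrightarrow> x \<otimes> y = y \<otimes> x"
    and self: "\<And>g. g \<in> carrier G \<Longrightarrow> (\<forall>x\<in>A. g \<otimes> x = x \<otimes> g) \<Longrightarrow> g \<in> A"
    using ex_self_centralizing_normal_abelian[OF fin cyc] by blast
  interpret A: normal A G by fact
  interpret GA: comm_group "G\<lparr>carrier := A\<rparr>"
    using subgroup_imp_group[OF A.subgroup_axioms] comm by (intro group.group_comm_groupI) auto
  have finA: "finite A" using fin A.subset finite_subset by blast
  obtain a where a: "a \<in> A" "ord a = card A"
    using GA.cyclic_if_cyclic_sylows[OF _ cyclic_sylows_normal[OF fin cyc A]] finA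
    by (auto simp: ord_subgroup[OF A.subgroup_axioms] order_def)
  have ac: "a \<in> carrier G" using a by simp
  have genA: "generate G {a} = A"
  proof (rule card_subset_eq[OF finA])
    show "generate G {a} \<subseteq> A" using generate_subgroup_incl[of "{a}" A] a A.subgroup_axioms by simp
    show "card (generate G {a}) = card A" using generate_pow_card[OF ac] a(2) by simp
  qed
  have self': "g \<in> generate G {a}" if g: "g \<in> carrier G" "g \<otimes> a = a \<otimes> g" for g
    unfolding genA
  proof (rule self[OF g(1)], rule ballI)
    fix x assume "x \<in> A"
    then obtain k :: nat where "x = a [^] k"
      using genA generate_pow_on_finite_carrier[OF fin ac] by blast
    then show "g \<otimes> x = x \<otimes> g" using group_commutes_pow[of a g k] g ac by simp
  qed
  have A': "generate G {a} \<lhd> G" using A genA by simp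
  define m where "m = card (rcosets A)"
  define N where "N = card A"
  have cop: "coprime N m"
    using coprime_card_index_self_centralizing[OF fin cyc center A' ac self']
    unfolding genA N_def m_def .
  have ordG: "m * N = order G" unfolding m_def N_def by (rule lagrange[OF A.subgroup_axioms])
  interpret Q: comm_group "G Mod A"
    using comm_group_quotient[OF A'
      commutator_mem_self_centralizing_cyclic[OF fin A' ac self']] unfolding genA by blast
  have ordQ: "order (G Mod A) = m" by (simp add: order_def FactGroup_def m_def)
  have "finite (carrier (G Mod A))" using fin by (simp add: carrier_FactGroup)
  then obtain X where X: "X \<in> carrier (G Mod A)" "Q.ord X = m"
    using Q.cyclic_if_cyclic_sylows[OF _ cyclic_sylows_quotient[OF fin cyc A]] ordQ by auto
  then obtain x where x: "x \<in> carrier G" "X = A #> x" by (auto simp: carrier_FactGroup)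
  have N0: "N \<noteq> 0" unfolding N_def using finA a by auto
  define b where "b = x [^] N"
  have bc: "b \<in> carrier G" using x by (simp add: b_def)
  have "b [^] m = \<one>"
    unfolding b_def using x ordG pow_order_eq_1[of x] by (simp add: nat_pow_pow mult.commute)
  then have "ord b dvd m" using pow_eq_id[OF bc] by blast
  moreover have "m dvd ord b"
  proof -
    have "x [^] (N * ord b) = b [^] ord b"
      unfolding b_def using x(1) by (rule nat_pow_pow[symmetric])
    then have "X [^]\<^bsub>G Mod A\<^esub> (N * ord b) = A #> (b [^] ord b)"
      unfolding x(2) A.FactGroup_pow[OF x(1)] by simp
    also have "\<dots> = \<one>\<^bsub>G Mod A\<^esub>" using bc A.subset by simp
    finally have "m dvd N * ord b" using Q.pow_eq_id[OF X(1)] X(2) by blast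
    then show ?thesis using cop coprime_commute coprime_dvd_mult_right_iff by blast
  qed
  ultimately have ob: "ord b = m" by (rule dvd_antisym)
  have B: "subgroup (generate G {b}) G" using bc by (intro generate_is_subgroup) simp
  have cB: "card (generate G {b}) = m" using generate_pow_card[OF bc] ob by simp
  have "card (A <#> generate G {b}) = N * m"
    using card_set_mult_coprime[OF A.subgroup_axioms B] cop cB by (simp add: N_def)
  then have "A <#> generate G {b} = carrier G"
    using card_subset_eq[OF fin, of "A <#> generate G {b}"] ordG
      setmult_subset_G[OF A.subset subgroup.subset[OF B]] by (simp add: order_def mult.commute)
  then show ?thesis
    using ac bc A' cop ob a(2) self' genA m_def N_def by (intro bexI[of _ a] bexI[of _ b]) auto
qed

end


section \<open>Conjugates of the complement and Frobenius groups\<close>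

lemma (in group) cyclic_sylows_if_Z_group:
  assumes fin: "finite (carrier G)" and Z: "Z_group G"
  shows "cyclic_sylows G"
  unfolding cyclic_sylows_def
proof (intro allI impI)
  fix p :: nat assume p: "Factorial_Ring.prime p"
  define v where "v = multiplicity p (order G)"
  have "p ^ v dvd order G" unfolding v_def by (rule multiplicity_dvd)
  then obtain m where "order G = p ^ v * m" by blast
  then obtain P where P: "subgroup P G" "card P = p ^ v"
    using sylow_thm[OF p is_group _ fin] by blast
  then have "cyclic_group (G\<lparr>carrier := P\<rparr>)"
    using Z p by (auto simp: Z_group_def sylow_subgroup_def v_def)
  then obtain x where x: "x \<in> P" "subgroup_generated (G\<lparr>carrier := P\<rparr>) {x} = G\<lparr>carrier := P\<rparr>"
    by (auto simp: cyclic_group_def)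
  interpret P: group "G\<lparr>carrier := P\<rparr>" by (rule subgroup_imp_group[OF P(1)])
  have "ord x = card P"
    using P.cyclic_order_is_ord[of x] x ord_subgroup[OF P(1)] by (simp add: order_def)
  then show "\<exists>y\<in>carrier G. ord y = p ^ multiplicity p (order G)"
    using P(2) subgroup.mem_carrier[OF P(1) x(1)] v_def by auto
qed

text \<open>Write \<open>b\<^sup>i = x \<beta>\<close> with \<open>\<beta> = a\<^sup>k\<close>, and let \<open>x\<close> act on \<open>A = \<langle>a\<rangle>\<close> as \<open>y \<mapsto> y\<^sup>s\<close>. Conjugating \<open>x\<close>
  by \<open>a\<^sup>j\<close> multiplies it by \<open>a\<close> to the power \<open>j(s - 1)\<close>, so \<open>j(s - 1) \<equiv> k\<close> modulo \<open>N = |A|\<close> must be solved,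
  that is, \<open>d = gcd(s - 1, N)\<close> must divide \<open>k\<close>. Both \<open>x\<close> and \<open>x \<beta>\<close> have trivial \<open>m\<close>-th power,
  where \<open>m = |B|\<close>, so \<open>N\<close> divides \<open>k (\<Sum>i<m. s\<^sup>i)\<close>, and the sum is congruent to \<open>m\<close> modulo
  \<open>d\<close>. Since \<open>m\<close> is coprime to \<open>N\<close>, it follows that \<open>d\<close> divides \<open>k\<close>.\<close>

lemma (in group) conj_into_complement:
  assumes fin: "finite (carrier G)" and A: "generate G {a} \<lhd> G"
    and a: "a \<in> carrier G" and b: "b \<in> carrier G" and cop: "coprime (ord a) (ord b)"
    and fact: "carrier G = generate G {a} <#> generate G {b}"
    and x: "x \<in> carrier G" and xb: "x [^] ord b = \<one>"
  shows "\<exists>g\<in>generate G {a}. \<exists>i::nat. g \<otimes> x \<otimes> inv g = b [^] i"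
proof -
  interpret A: normal "generate G {a}" G by fact
  have genA: "generate G {a} = {a [^] k | k. k \<in> (UNIV :: nat set)}"
    using generate_pow_on_finite_carrier[OF fin a] .
  define N where "N = ord a"
  define m where "m = ord b"
  have N1: "N \<ge> 1" unfolding N_def by (rule ord_ge_1[OF fin a])
  obtain \<gamma> i where \<gamma>: "\<gamma> \<in> generate G {a}" and xi: "x = \<gamma> \<otimes> b [^] (i::nat)"
    using x fact generate_pow_on_finite_carrier[OF fin b] by (auto simp: set_mult_def)
  have \<gamma>c: "\<gamma> \<in> carrier G" using \<gamma> by simp
  define \<beta> where "\<beta> = inv x \<otimes> b [^] i"
  have bi: "b [^] i = x \<otimes> \<beta>" unfolding \<beta>_def using x b by (simp add: cancel_inv_left)
  have "\<beta> = inv x \<otimes> inv \<gamma> \<otimes> x"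
    unfolding \<beta>_def using xi \<gamma>c b x by (simp add: m_assoc cancel_inv_left)
  then have "\<beta> \<in> generate G {a}" using A.inv_op_closed1[OF x A.m_inv_closed[OF \<gamma>]] by simp
  then obtain k :: nat where k: "\<beta> = a [^] k" unfolding genA by blast
  obtain s :: nat where s: "\<And>y. y \<in> generate G {a} \<Longrightarrow> inv x \<otimes> y \<otimes> x = y [^] s"
    using normal_cyclic_conj_pow[OF fin A a x] by blast
  have pow: "a [^] j \<in> generate G {a}" for j :: nat unfolding genA by blast
  define E where "E = (\<Sum>i<m. s ^ i)"
  have "(x \<otimes> \<beta>) [^] m = x [^] m \<otimes> \<beta> [^] E"
    unfolding E_def k by (rule twisted_pow[OF x _ s[OF pow]]) (use a in simp)
  moreover have "(x \<otimes> \<beta>) [^] m = \<one>"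
  proof -
    have "(b [^] i) [^] m = (b [^] m) [^] i" using b by (simp add: nat_pow_pow mult.commute)
    then show ?thesis unfolding bi[symmetric] using b by (simp add: m_def)
  qed
  ultimately have "a [^] (k * E) = \<one>" using xb a by (simp add: m_def k nat_pow_pow)
  then have NkE: "N dvd k * E" using pow_eq_id[OF a] by (simp add: N_def)
  (* D stands for s - 1 modulo N; adding N keeps it a natural number when s = 0. *)
  define D where "D = s + (N - 1)"
  define d where "d = gcd D N"
  have "[s = 1] (mod d)"
  proof -
    have "[s + N = s + 0] (mod d)"
      by (intro cong_add) (auto simp: cong_0_iff d_def)
    moreover have "s + N = D + 1" using N1 by (simp add: D_def)
    moreover have "[D + 1 = 0 + 1] (mod d)"
      by (intro cong_add) (auto simp: cong_0_iff d_def)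
    ultimately show ?thesis by (metis add.right_neutral add_0 cong_sym cong_trans)
  qed
  then have "[E = (\<Sum>i<m. 1 ^ i)] (mod d)" unfolding E_def by (intro cong_sum cong_pow)
  then have "[k * E = k * m] (mod d)" by (intro cong_mult) auto
  moreover have "d dvd k * E" using NkE by (auto simp: d_def intro: dvd_trans)
  ultimately have "d dvd k * m" using cong_dvd_iff by blast
  moreover have "coprime d m" using coprime_divisors[of d N m m] cop by (simp add: N_def m_def d_def)
  ultimately have "gcd D N dvd k" using coprime_dvd_mult_left_iff unfolding d_def by blast
  then obtain j where j: "[D * j = k] (mod N)" using cong_solve_dvd_nat by blast
  define g where "g = a [^] j"
  have gc: "g \<in> carrier G" and gA: "g \<in> generate G {a}" using a pow by (auto simp: g_def)
  have "[s * j = k + j] (mod N)"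
  proof -
    have "[s * j + N * j = s * j + 0] (mod N)" by (intro cong_add) (auto simp: cong_0_iff)
    moreover have "s * j + N * j = D * j + j"
    proof -
      have "s * j + N * j = (s + N) * j" by (simp add: add_mult_distrib)
      also have "s + N = Suc D" using N1 by (simp add: D_def)
      finally show ?thesis by simp
    qed
    moreover have "[D * j + j = k + j] (mod N)" using j by (intro cong_add) auto
    ultimately show ?thesis by (metis add.right_neutral cong_sym cong_trans)
  qed
  then have "a [^] (s * j) = a [^] (k + j)" using pow_eq_iff_cong[OF a] by (simp add: N_def)
  then have gs: "g [^] s = \<beta> \<otimes> g"
    using a by (simp add: g_def k nat_pow_pow nat_pow_mult mult.commute)
  have "g \<otimes> x \<otimes> inv g = x \<otimes> (inv x \<otimes> g \<otimes> x) \<otimes> inv g"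
    using gc x by (simp add: m_assoc cancel_inv_left)
  also have "\<dots> = x \<otimes> (\<beta> \<otimes> g) \<otimes> inv g" using s[OF gA] gs by simp
  also have "\<dots> = x \<otimes> \<beta>" using gc x a k by (simp add: m_assoc)
  finally have "g \<otimes> x \<otimes> inv g = b [^] i" using bi by simp
  then show ?thesis using gA by blast
qed

lemma (in group) generate_singleton_commute:
  assumes "finite (carrier G)" "a \<in> carrier G" "x \<in> generate G {a}" "y \<in> generate G {a}"
  shows "x \<otimes> y = y \<otimes> x"
proof -
  obtain i j :: nat where "x = a [^] i" "y = a [^] j"
    using assms generate_pow_on_finite_carrier[OF assms(1,2)] by blast
  then show ?thesis using assms(2) by (simp add: nat_pow_mult add.commute)
qed

text \<open>
  Otherwise \<open>B = \<langle>b\<rangle>\<close> is a Frobenius complement: let \<open>y \<in> B\<close> be conjugate under \<open>g = \<alpha> h\<close> to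
  \<open>w \<in> B\<close>, with \<open>\<alpha> \<in> A\<close> and \<open>h \<in> B\<close>. Then \<open>\<alpha> y = w \<alpha>\<close>, and \<open>y = w\<close> because \<open>y\<close> and \<open>w\<close> are
  congruent modulo \<open>A\<close>. So \<open>\<alpha>\<close>, which is nontrivial if \<open>g \<notin> B\<close>, commutes with \<open>y\<close>.\<close>

lemma (in group) ex_commuting_if_not_frobenius:
  assumes fin: "finite (carrier G)" and nonab: "\<not> comm_group G" and nf: "\<not> frobenius_group G"
    and A: "generate G {a} \<lhd> G" and a: "a \<in> carrier G" and b: "b \<in> carrier G"
    and cop: "coprime (ord a) (ord b)"
    and fact: "carrier G = generate G {a} <#> generate G {b}"
  shows "\<exists>x\<in>generate G {a} - {\<one>}. \<exists>y\<in>generate G {b} - {\<one>}. x \<otimes> y = y \<otimes> x"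
proof (rule ccontr)
  assume none: "\<not> ?thesis"
  interpret A: normal "generate G {a}" G by fact
  let ?A = "generate G {a}" and ?B = "generate G {b}"
  have B: "subgroup ?B G" using b by (intro generate_is_subgroup) simp
  interpret B: subgroup ?B G by (rule B)
  have AB: "x = \<one>" if "x \<in> ?A" "x \<in> ?B" for x
    using eq_one_if_mem_coprime_subgroups[OF A.subgroup_axioms B _ that] cop
    by (simp add: generate_pow_card a b)
  have not_single: "carrier G \<noteq> generate G {c}" if "c \<in> carrier G" for c
  proof
    assume "carrier G = generate G {c}"
    then have "comm_group G"
      using generate_singleton_commute[OF fin that] by (intro group_comm_groupI) blast
    with nonab show False by blast
  qed
  have "frobenius_group G"
    unfolding frobenius_group_def
  proof (intro conjI exI[of _ ?B] ballI)
    show "group G" by (rule is_group)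
    show "subgroup ?B G" by (rule B)
    show "?B \<noteq> {\<one>}"
    proof
      assume "?B = {\<one>}"
      then have "carrier G = ?A" unfolding fact by (auto simp: set_mult_def)
      then show False using not_single[OF a] by blast
    qed
    show "?B \<noteq> carrier G" using not_single[OF b] by blast
  next
    fix g assume g: "g \<in> carrier G - ?B"
    then have gc: "g \<in> carrier G" by simp
    obtain \<alpha> h where \<alpha>: "\<alpha> \<in> ?A" and h: "h \<in> ?B" and gh: "g = \<alpha> \<otimes> h"
      using gc fact by (auto simp: set_mult_def)
    have c: "\<alpha> \<in> carrier G" "h \<in> carrier G" using \<alpha> h by auto
    have "y = \<one>" if y: "y \<in> ?B" and y': "y \<in> (inv g <# ?B) #> g" for y
    proof -
      obtain w where w: "w \<in> ?B" "y = inv g \<otimes> w \<otimes> g"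
        using y' by (auto simp: l_coset_def r_coset_def)
      have wc: "w \<in> carrier G" and yc: "y \<in> carrier G" using w(1) y by auto
      have "g \<otimes> y = w \<otimes> g" unfolding w(2) using gc wc by (simp add: m_assoc cancel_inv_left)
      then have "\<alpha> \<otimes> (h \<otimes> y) = w \<otimes> \<alpha> \<otimes> h" unfolding gh using c wc yc by (simp add: m_assoc)
      also have "h \<otimes> y = y \<otimes> h" using generate_singleton_commute[OF fin b h y] .
      finally have "(\<alpha> \<otimes> y) \<otimes> h = (w \<otimes> \<alpha>) \<otimes> h" using c yc by (simp add: m_assoc)
      then have \<alpha>y: "\<alpha> \<otimes> y = w \<otimes> \<alpha>" using c wc yc by simp
      have "y \<otimes> inv w = inv \<alpha> \<otimes> (w \<otimes> \<alpha> \<otimes> inv w)"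
      proof -
        have "y = inv \<alpha> \<otimes> (\<alpha> \<otimes> y)" using c yc by (simp add: cancel_inv_left)
        then have "y \<otimes> inv w = inv \<alpha> \<otimes> (w \<otimes> \<alpha>) \<otimes> inv w" unfolding \<alpha>y by simp
        then show ?thesis using c wc by (simp add: m_assoc)
      qed
      moreover have "inv \<alpha> \<otimes> (w \<otimes> \<alpha> \<otimes> inv w) \<in> ?A" using A.inv_op_closed2[OF wc \<alpha>] \<alpha> by simp
      moreover have "y \<otimes> inv w \<in> ?B" using y w(1) by simp
      ultimately have "y \<otimes> inv w = \<one>" using AB by simp
      then have "y = w" using yc wc by (metis inv_closed inv_inv inv_equality)
      then have "\<alpha> \<otimes> y = y \<otimes> \<alpha>" using \<alpha>y by simp
      moreover have "\<alpha> \<noteq> \<one>" using g gh h c by auto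
      ultimately show "y = \<one>" using none \<alpha> y by blast
    qed
    moreover have "\<one> \<in> (inv g <# ?B) #> g"
      using gc B.one_closed unfolding l_coset_def r_coset_def
      by (auto intro!: bexI[of _ \<one>])
    ultimately show "?B \<inter> ((inv g <# ?B) #> g) = {\<one>}" using B.one_closed by blast
  qed
  with nf show False by blast
qed


section \<open>Distances in the commuting graph\<close>

text \<open>
  Lengths of walks are natural numbers. So if some distance exceeds \<open>m\<close>, then it is at least
  \<open>m + 1\<close>, and the diameter, a supremum of extended reals, takes no value in between.\<close>

lemma (in wf_digraph) graph_diameter_cases:
  assumes short: "\<And>u v. u \<in> verts G \<Longrightarrow> v \<in> verts G \<Longrightarrow> \<exists>p. awalk u p v \<and> length p \<le> Suc m"
    and uv: "u \<in> verts G" "v \<in> verts G" and long: "\<And>p. awalk u p v \<Longrightarrow> m \<le> length p"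
  shows "graph_diameter G = ereal (real m) \<or> graph_diameter G = ereal (real (Suc m))"
proof -
  have cost: "awalk_cost (\<lambda>_. 1) p = real (length p)" for p
    by (induction p) auto
  have up: "\<mu> (\<lambda>_. 1) x y \<le> ereal (real n)" if "awalk x p y" "length p \<le> n" for x y p n
  proof -
    have "\<mu> (\<lambda>_. 1) x y \<le> ereal (real (length p))"
      using min_cost_le_walk_cost[OF that(1), of "\<lambda>_. 1"] by (simp add: cost)
    also have "\<dots> \<le> ereal (real n)" using that(2) by simp
    finally show ?thesis .
  qed
  have low: "ereal (real n) \<le> \<mu> (\<lambda>_. 1) x y" if "\<And>p. awalk x p y \<Longrightarrow> n \<le> length p" for x y n
    unfolding \<mu>_def using that by (intro INF_greatest) (simp add: cost)
  have le: "graph_diameter G \<le> ereal (real n)"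
    if "\<And>x y. x \<in> verts G \<Longrightarrow> y \<in> verts G \<Longrightarrow> \<mu> (\<lambda>_. 1) x y \<le> ereal (real n)" for n
    unfolding graph_diameter_def using that by (intro SUP_least)
  have ge: "ereal (real n) \<le> graph_diameter G"
    if "x \<in> verts G" "y \<in> verts G" "ereal (real n) \<le> \<mu> (\<lambda>_. 1) x y" for n x y
    unfolding graph_diameter_def using that by (intro SUP_upper2[of x] SUP_upper2[of y]) auto
  have upper: "graph_diameter G \<le> ereal (real (Suc m))"
    using short up by (intro le) blast
  show ?thesis
  proof (cases "\<exists>x\<in>verts G. \<exists>y\<in>verts G. \<forall>p. awalk x p y \<longrightarrow> Suc m \<le> length p")
    case True
    then have "ereal (real (Suc m)) \<le> graph_diameter G" using low ge by blast
    with upper show ?thesis by simp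
  next
    case False
    have "graph_diameter G \<le> ereal (real m)"
    proof (rule le)
      fix x y assume "x \<in> verts G" "y \<in> verts G"
      then obtain p where p: "awalk x p y" "\<not> Suc m \<le> length p" using False by blast
      then show "\<mu> (\<lambda>_. 1) x y \<le> ereal (real m)" using up[OF p(1), of m] by simp
    qed
    moreover have "ereal (real m) \<le> graph_diameter G" by (rule ge[OF uv low[OF long]])
    ultimately show ?thesis by simp
  qed
qed

lemma (in wf_digraph) connected_if_all_reachable:
  assumes "verts G \<noteq> {}" and "\<And>u v. u \<in> verts G \<Longrightarrow> v \<in> verts G \<Longrightarrow> \<exists>p. awalk u p v"
  shows "connected G"
  using assms reachable_mk_symmetricI reachable_awalk
  by (auto simp: connected_def strongly_connected_def)

text \<open>
  The bound \<open>Suc n\<close> need not be attained: if \<open>u\<close> and \<open>w\<close> coincide there is no arc to add, so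
  chains of commuting vertices may contain repetitions.\<close>

lemma awalk_commuting_graph_Cons:
  assumes "finite (carrier G)"
    and "u \<in> carrier G - center G" "w \<in> carrier G - center G" "u \<otimes>\<^bsub>G\<^esub> w = w \<otimes>\<^bsub>G\<^esub> u"
    and "\<exists>p. pre_digraph.awalk (with_proj (commuting_graph G)) w p v \<and> length p \<le> n"
  shows "\<exists>p. pre_digraph.awalk (with_proj (commuting_graph G)) u p v \<and> length p \<le> Suc n"
proof -
  interpret pair_graph "commuting_graph G" by (rule pair_graph_commuting_graph[OF assms(1)])
  obtain p where p: "awalk w p v" "length p \<le> n" using assms(5) by blast
  show ?thesis
  proof (cases "u = w")
    case True
    then show ?thesis using p by (intro exI[of _ p]) auto
  next
    case False
    then have "(u, w) \<in> parcs (commuting_graph G)" using assms by (simp add: commuting_graph_def)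
    then have "awalk u ((u, w) # p) v" using p by (simp add: awalk_Cons_iff)
    then show ?thesis using p by (intro exI[of _ "(u, w) # p"]) auto
  qed
qed

text \<open>
  Commutation is reflexive, so a walk with fewer than two arcs also provides such a vertex,
  namely one of its ends.\<close>

lemma ex_commuting_vertex_if_short_awalk:
  assumes "finite (carrier G)"
    and "pre_digraph.awalk (with_proj (commuting_graph G)) u p v" "length p \<le> 2"
  shows "\<exists>z\<in>carrier G - center G. u \<otimes>\<^bsub>G\<^esub> z = z \<otimes>\<^bsub>G\<^esub> u \<and> z \<otimes>\<^bsub>G\<^esub> v = v \<otimes>\<^bsub>G\<^esub> z"
proof -
  interpret pair_graph "commuting_graph G" by (rule pair_graph_commuting_graph[OF assms(1)])
  have arc: "(x, y) \<in> parcs (commuting_graph G) \<longleftrightarrow> x \<in> carrier G - center G \<and>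
    y \<in> carrier G - center G \<and> x \<noteq> y \<and> x \<otimes>\<^bsub>G\<^esub> y = y \<otimes>\<^bsub>G\<^esub> x" for x y
    by (simp add: commuting_graph_def)
  consider "p = []" | e where "p = [e]" | e f where "p = [e, f]"
    using assms(3) by (cases p; cases "tl p") auto
  then show ?thesis
  proof cases
    case 1
    then have "u = v" "u \<in> pverts (commuting_graph G)"
      using assms(2) by (auto simp: awalk_Nil_iff)
    then have "u = v" "u \<in> carrier G - center G" by (simp_all add: commuting_graph_def)
    then show ?thesis by blast
  next
    case 2
    then have "(u, v) \<in> parcs (commuting_graph G)"
      using assms(2) by (cases e) (auto simp: awalk_Cons_iff awalk_Nil_iff)
    then show ?thesis unfolding arc by (intro bexI[of _ u]) auto
  next
    case 3
    then obtain w where "(u, w) \<in> parcs (commuting_graph G)" "(w, v) \<in> parcs (commuting_graph G)"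
      using assms(2) by (cases e; cases f) (auto simp: awalk_Cons_iff awalk_Nil_iff)
    then show ?thesis unfolding arc by (intro bexI[of _ w]) auto
  qed
qed


theorem corollary6:
  fixes G :: "('a, 'b) monoid_scheme"
  assumes "group G"
    and "finite (carrier G)"
    and "\<not> comm_group G"
    and "Z_group G"
    and "center G = {\<one>\<^bsub>G\<^esub>}"
    and "\<not> frobenius_group G"
  shows "Digraph_Component.connected (with_proj (commuting_graph G)) \<and>
    (graph_diameter (with_proj (commuting_graph G)) = 3 \<or>
     graph_diameter (with_proj (commuting_graph G)) = 4)"
proof -
  interpret group G by fact
  note fin = \<open>finite (carrier G)\<close> and center = \<open>center G = {\<one>\<^bsub>G\<^esub>}\<close>
  interpret \<Gamma>: pair_graph "commuting_graph G" by (rule pair_graph_commuting_graph[OF fin])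
  have cyc: "cyclic_sylows G" by (rule cyclic_sylows_if_Z_group[OF fin \<open>Z_group G\<close>])
  obtain a b where a: "a \<in> carrier G" and b: "b \<in> carrier G"
    and A: "generate G {a} \<lhd> G" and cop: "coprime (ord a) (ord b)"
    and fact: "carrier G = generate G {a} <#>\<^bsub>G\<^esub> generate G {b}"
    and self: "\<And>g. g \<in> carrier G \<Longrightarrow> g \<otimes>\<^bsub>G\<^esub> a = a \<otimes>\<^bsub>G\<^esub> g \<Longrightarrow> g \<in> generate G {a}"
    and index: "card (rcosets\<^bsub>G\<^esub> (generate G {a})) = ord b"
    using ex_cyclic_hall_factorization[OF fin cyc center] by blast
  interpret A: normal "generate G {a}" G by (rule A)
  have B: "subgroup (generate G {b}) G" using b by (intro generate_is_subgroup) simp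
  have A_comm: "x \<otimes>\<^bsub>G\<^esub> y = y \<otimes>\<^bsub>G\<^esub> x" if "x \<in> generate G {a}" "y \<in> generate G {a}" for x y
    using generate_singleton_commute[OF fin a that] .
  have B_comm: "x \<otimes>\<^bsub>G\<^esub> y = y \<otimes>\<^bsub>G\<^esub> x" if "x \<in> generate G {b}" "y \<in> generate G {b}" for x y
    using generate_singleton_commute[OF fin b that] .
  have V: "pverts (commuting_graph G) = carrier G - center G" by (simp add: commuting_graph_def)
  obtain a0 b0 where a0: "a0 \<in> generate G {a}" "a0 \<noteq> \<one>\<^bsub>G\<^esub>"
    and b0: "b0 \<in> generate G {b}" "b0 \<noteq> \<one>\<^bsub>G\<^esub>" and ab0: "a0 \<otimes>\<^bsub>G\<^esub> b0 = b0 \<otimes>\<^bsub>G\<^esub> a0"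
    using ex_commuting_if_not_frobenius[OF fin \<open>\<not> comm_group G\<close> \<open>\<not> frobenius_group G\<close> A a b cop fact]
    by blast
  have a0c: "a0 \<in> carrier G" and b0c: "b0 \<in> carrier G"
    using a0 b0 subgroup.mem_carrier[OF B] by auto
  have a0V: "a0 \<in> carrier G - center G" using a0 a0c center by simp
  (* The whole graph lies within distance 2 of a0. *)
  have near_a0: "\<exists>c\<in>carrier G - center G. x \<otimes>\<^bsub>G\<^esub> c = c \<otimes>\<^bsub>G\<^esub> x \<and> c \<otimes>\<^bsub>G\<^esub> a0 = a0 \<otimes>\<^bsub>G\<^esub> c"
    if x: "x \<in> carrier G - center G" for x
  proof -
    have xc: "x \<in> carrier G" using x by simp
    show ?thesis
    proof (cases "x [^]\<^bsub>G\<^esub> ord b = \<one>\<^bsub>G\<^esub>")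
      case False
      define c where "c = x [^]\<^bsub>G\<^esub> ord b"
      have "c \<in> generate G {a}" using pow_index_mem[OF A xc] unfolding index c_def .
      moreover have "x \<otimes>\<^bsub>G\<^esub> c = c \<otimes>\<^bsub>G\<^esub> x"
        unfolding c_def using group_commutes_pow[of x x "ord b"] xc by simp
      ultimately show ?thesis
        using False A_comm[OF _ a0(1)] center by (intro bexI[of _ c]) (auto simp: c_def xc)
    next
      case True
      obtain g i where g: "g \<in> generate G {a}" and i: "g \<otimes>\<^bsub>G\<^esub> x \<otimes>\<^bsub>G\<^esub> inv\<^bsub>G\<^esub> g = b [^]\<^bsub>G\<^esub> (i::nat)"
        using conj_into_complement[OF fin A a b cop fact xc True] by blast
      have gc: "g \<in> carrier G" using g by simp
      define h where "h = inv\<^bsub>G\<^esub> g"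
      have hc: "h \<in> carrier G" and hA: "h \<in> generate G {a}" using gc g by (simp_all add: h_def)
      define c where "c = h \<otimes>\<^bsub>G\<^esub> b0 \<otimes>\<^bsub>G\<^esub> inv\<^bsub>G\<^esub> h"
      have cc: "c \<in> carrier G" using hc b0c by (simp add: c_def)
      have xeq: "x = h \<otimes>\<^bsub>G\<^esub> b [^]\<^bsub>G\<^esub> i \<otimes>\<^bsub>G\<^esub> inv\<^bsub>G\<^esub> h"
        unfolding i[symmetric] h_def using gc xc by (simp add: m_assoc cancel_inv_left)
      have "b [^]\<^bsub>G\<^esub> i \<in> generate G {b}"
        by (rule nat_pow_mem_subgroup[OF B]) (rule generate.incl, simp)
      then have "x \<otimes>\<^bsub>G\<^esub> c = c \<otimes>\<^bsub>G\<^esub> x"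
        unfolding c_def xeq using hc b b0c B_comm[OF _ b0(1)] by (intro commute_conj) auto
      moreover have "c \<otimes>\<^bsub>G\<^esub> a0 = a0 \<otimes>\<^bsub>G\<^esub> c"
      proof -
        have "h \<otimes>\<^bsub>G\<^esub> a0 \<otimes>\<^bsub>G\<^esub> inv\<^bsub>G\<^esub> h = a0"
          using A_comm[OF hA a0(1)] hc a0c by (simp add: m_assoc)
        then show ?thesis unfolding c_def
          using commute_conj[OF hc b0c a0c ab0[symmetric]] by simp
      qed
      moreover have "c \<noteq> \<one>\<^bsub>G\<^esub>"
        using ord_conj[OF hc b0c] b0(2) ord_eq_1[OF cc] ord_eq_1[OF b0c] unfolding c_def by metis
      ultimately show ?thesis using cc center by (intro bexI[of _ c]) auto
    qed
  qed
  have short: "\<exists>p. \<Gamma>.awalk x p y \<and> length p \<le> Suc 3"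
    if x: "x \<in> carrier G - center G" and y: "y \<in> carrier G - center G" for x y
  proof -
    obtain c where c: "c \<in> carrier G - center G" "x \<otimes>\<^bsub>G\<^esub> c = c \<otimes>\<^bsub>G\<^esub> x" "c \<otimes>\<^bsub>G\<^esub> a0 = a0 \<otimes>\<^bsub>G\<^esub> c"
      using near_a0[OF x] by blast
    obtain d where d: "d \<in> carrier G - center G" "y \<otimes>\<^bsub>G\<^esub> d = d \<otimes>\<^bsub>G\<^esub> y" "d \<otimes>\<^bsub>G\<^esub> a0 = a0 \<otimes>\<^bsub>G\<^esub> d"
      using near_a0[OF y] by blast
    have "\<exists>p. \<Gamma>.awalk y p y \<and> length p \<le> 0" using y V by (simp add: \<Gamma>.awalk_Nil_iff)
    then have "\<exists>p. \<Gamma>.awalk d p y \<and> length p \<le> Suc 0"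
      by (rule awalk_commuting_graph_Cons[OF fin d(1) y d(2)[symmetric]])
    then have "\<exists>p. \<Gamma>.awalk a0 p y \<and> length p \<le> Suc (Suc 0)"
      by (rule awalk_commuting_graph_Cons[OF fin a0V d(1) d(3)[symmetric]])
    then have "\<exists>p. \<Gamma>.awalk c p y \<and> length p \<le> Suc (Suc (Suc 0))"
      by (rule awalk_commuting_graph_Cons[OF fin c(1) a0V c(3)])
    then have "\<exists>p. \<Gamma>.awalk x p y \<and> length p \<le> Suc (Suc (Suc (Suc 0)))"
      by (rule awalk_commuting_graph_Cons[OF fin x c(1,2)])
    then show ?thesis by (simp add: numeral_3_eq_3)
  qed
  have ne: "c \<in> carrier G - center G"
    if c: "c \<in> carrier G" and x: "x \<in> generate G {c}" "x \<noteq> \<one>\<^bsub>G\<^esub>" for c x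
  proof -
    obtain k :: nat where "x = c [^]\<^bsub>G\<^esub> k" using x generate_pow_on_finite_carrier[OF fin c] by blast
    then have "c \<noteq> \<one>\<^bsub>G\<^esub>" using x(2) by auto
    then show ?thesis using c center by simp
  qed
  have aV: "a \<in> carrier G - center G" and bV: "b \<in> carrier G - center G"
    using ne[OF a a0] ne[OF b b0] by auto
  have long: "3 \<le> length p" if p: "\<Gamma>.awalk a p b" for p
  proof (rule ccontr)
    assume "\<not> 3 \<le> length p"
    then have "length p \<le> 2" by simp
    then obtain z where z: "z \<in> carrier G - center G"
      and za: "a \<otimes>\<^bsub>G\<^esub> z = z \<otimes>\<^bsub>G\<^esub> a" and zb: "z \<otimes>\<^bsub>G\<^esub> b = b \<otimes>\<^bsub>G\<^esub> z"
      using ex_commuting_vertex_if_short_awalk[OF fin p] by blast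
    have zc: "z \<in> carrier G" using z by simp
    have zA: "z \<in> generate G {a}" by (rule self[OF zc za[symmetric]])
    have "g \<otimes>\<^bsub>G\<^esub> z = z \<otimes>\<^bsub>G\<^esub> g" if "g \<in> carrier G" for g
    proof -
      obtain \<alpha> i where g: "\<alpha> \<in> generate G {a}" "g = \<alpha> \<otimes>\<^bsub>G\<^esub> b [^]\<^bsub>G\<^esub> (i::nat)"
        using \<open>g \<in> carrier G\<close> fact generate_pow_on_finite_carrier[OF fin b] by (auto simp: set_mult_def)
      have \<alpha>c: "\<alpha> \<in> carrier G" using g by simp
      have "b [^]\<^bsub>G\<^esub> i \<otimes>\<^bsub>G\<^esub> z = z \<otimes>\<^bsub>G\<^esub> b [^]\<^bsub>G\<^esub> i" using group_commutes_pow[OF zb[symmetric] b zc] .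
      moreover have "\<alpha> \<otimes>\<^bsub>G\<^esub> z = z \<otimes>\<^bsub>G\<^esub> \<alpha>" using A_comm[OF g(1) zA] .
      ultimately show ?thesis unfolding g(2) using \<alpha>c b zc by (metis m_assoc nat_pow_closed)
    qed
    then have "z \<in> center G" using zc by (simp add: center_def)
    with z show False by blast
  qed
  have "Digraph_Component.connected (with_proj (commuting_graph G))"
    by (rule \<Gamma>.connected_if_all_reachable) (use aV short V in \<open>auto, blast\<close>)
  moreover have "graph_diameter (with_proj (commuting_graph G)) = ereal (real 3) \<or>
      graph_diameter (with_proj (commuting_graph G)) = ereal (real (Suc 3))"
    by (rule \<Gamma>.graph_diameter_cases[where u = a and v = b]) (use short long aV bV V in simp_all)
  ultimately show ?thesis by simp
qed

end
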